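(* Sorted Enum (given a graph database $\mathcal D$ and an RPQ $q$, enumerate $q(\mathcal D)$ in lexicographic order) can be solved with delay $O(|\mathcal D|\,|q|)$ (preprocessing included in this bound) and update time $O(1)$ in the dynamic setting.
   Context: $\Sigma$ is a fixed finite alphabet of constant size. A graph database over $\Sigma$ is a pair $\mathcal{D}=(V_{\mathcal D},E_{\mathcal D})$ with a finite node set and arc set $E_{\mathcal D}\subseteq V_{\mathcal D}\times\Sigma\times V_{\mathcal D}$, of size $|\mathcal D|=\max\{|V_{\mathcal D}|,|E_{\mathcal D}|\}$. It is represented by a list of its nodes, whose order defines a linear order $\preceq$ on $V_{\mathcal D}$, and for every node $u$ and letter $x$ a list of the $x$-successors of $u$. A path from $u$ to $v$ is a sequence $u=w_0,a_1,w_1,\dots,a_k,w_k=v$ ($k\ge0$) with $(w_{i-1},a_i,w_i)\in E_{\mathcal D}$, labelled by $a_1\cdots a_k$. An RPQ $q$ is a regular expression over $\Sigma$ (built from $\varepsilon$, letters, concatenation, alternation, Kleene plus), $|q|$ its length; $q(\mathcal D)$ is the set of node pairs $(u,v)$ such that some path from $u$ to $v$ is labelled by a word in the language of $q$. Model: RAM with logarithmic word size. Enumeration: an algorithm runs a preprocessing phase and then an enumeration phase that outputs every element of $q(\mathcal D)$ exactly once and then signals termination; the delay is the maximum time elapsing between start of enumeration and first output, between consecutive outputs, and between the last output and termination. "Solved with delay $d$" means the preprocessing time is also $O(d)$. Sorted: outputs are in lexicographic order with respect to $\preceq$. Dynamic setting: updates are insertion of an arc between existing nodes, deletion of an arc,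 insertion of an isolated node, deletion of an isolated node; after each update an update routine runs (its time is the update time), after which the enumeration lists the result on the updated database. *)

theory Defs
  imports Main
begin

record ('v, 'a) graph_db =
  verts :: "'v set"
  arcs :: "('v \<times> 'a \<times> 'v) set"

definition db_size :: "('v, 'a) graph_db \<Rightarrow> nat" where
  "db_size D = max (card (verts D)) (card (arcs D))"

inductive path :: "('v, 'a) graph_db \<Rightarrow> 'v \<Rightarrow> 'a list \<Rightarrow> 'v \<Rightarrow> bool" for D where
  path_Nil: "u \<in> verts D \<Longrightarrow> path D u [] u"
| path_Cons: "(u, a, w) \<in> arcs D \<Longrightarrow> path D w as v \<Longrightarrow> path D u (a # as) v"

datatype 'a rpq =
    Eps
  | Letter 'a
  | Conc "'a rpq" "'a rpq"
  | Alt "'a rpq" "'a rpq"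
  | Plus "'a rpq"

fun lang :: "'a rpq \<Rightarrow> 'a list set" where
  "lang Eps = {[]}"
| "lang (Letter a) = {[a]}"
| "lang (Conc r s) = {xs @ ys | xs ys. xs \<in> lang r \<and> ys \<in> lang s}"
| "lang (Alt r s) = lang r \<union> lang s"
| "lang (Plus r) = {concat ws | ws. ws \<noteq> [] \<and> set ws \<subseteq> lang r}"

fun rpq_length :: "'a rpq \<Rightarrow> nat" where
  "rpq_length Eps = 1"
| "rpq_length (Letter a) = 1"
| "rpq_length (Conc r s) = 1 + rpq_length r + rpq_length s"
| "rpq_length (Alt r s) = 1 + rpq_length r + rpq_length s"
| "rpq_length (Plus r) = 1 + rpq_length r"

definition rpq_result :: "'a rpq \<Rightarrow> ('v, 'a) graph_db \<Rightarrow> ('v \<times> 'v) set" where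
  "rpq_result q D = {(u, v). u \<in> verts D \<and> v \<in> verts D \<and> (\<exists>as \<in> lang q. path D u as v)}"

text \<open>
  From here on the alphabet is \<open>{..<sigma}\<close> and nodes are natural numbers. Values of
  \<open>succ_list\<close> at non-nodes or at numbers that are not letters are irrelevant.
\<close>

record db_rep =
  node_list :: "nat list"
  succ_list :: "nat \<Rightarrow> nat \<Rightarrow> nat list"

definition valid_rep :: "nat \<Rightarrow> db_rep \<Rightarrow> bool" where
  "valid_rep sigma R \<longleftrightarrow> distinct (node_list R) \<and>
     (\<forall>u \<in> set (node_list R). \<forall>x < sigma.
        distinct (succ_list R u x) \<and> set (succ_list R u x) \<subseteq> set (node_list R))"

definition db_of :: "nat \<Rightarrow> db_rep \<Rightarrow> (nat, nat) graph_db" where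
  "db_of sigma R =
     \<lparr>verts = set (node_list R),
      arcs = {(u, x, v). u \<in> set (node_list R) \<and> x < sigma \<and> v \<in> set (succ_list R u x)}\<rparr>"

definition node_le :: "db_rep \<Rightarrow> nat \<Rightarrow> nat \<Rightarrow> bool" where
  "node_le R u v \<longleftrightarrow>
     (\<exists>i j. i \<le> j \<and> j < length (node_list R) \<and> node_list R ! i = u \<and> node_list R ! j = v)"

definition pair_le :: "db_rep \<Rightarrow> nat \<times> nat \<Rightarrow> nat \<times> nat \<Rightarrow> bool" where
  "pair_le R p p' \<longleftrightarrow>
     (fst p \<noteq> fst p' \<and> node_le R (fst p) (fst p')) \<or>
     (fst p = fst p' \<and> node_le R (snd p) (snd p'))"

datatype db_update =
    Insert_Arc nat nat nat
  | Delete_Arc nat nat nat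
  | Insert_Node nat
  | Delete_Node nat

fun legal_update :: "nat \<Rightarrow> db_update \<Rightarrow> (nat, nat) graph_db \<Rightarrow> bool" where
  "legal_update sigma (Insert_Arc u x v) D \<longleftrightarrow> u \<in> verts D \<and> x < sigma \<and> v \<in> verts D"
| "legal_update sigma (Delete_Arc u x v) D \<longleftrightarrow> (u, x, v) \<in> arcs D"
| "legal_update sigma (Insert_Node u) D \<longleftrightarrow> u \<notin> verts D"
| "legal_update sigma (Delete_Node u) D \<longleftrightarrow>
     u \<in> verts D \<and> (\<forall>(v, x, w) \<in> arcs D. v \<noteq> u \<and> w \<noteq> u)"

fun apply_update :: "db_update \<Rightarrow> (nat, nat) graph_db \<Rightarrow> (nat, nat) graph_db" where
  "apply_update (Insert_Arc u x v) D = D\<lparr>arcs := insert (u, x, v) (arcs D)\<rparr>"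
| "apply_update (Delete_Arc u x v) D = D\<lparr>arcs := arcs D - {(u, x, v)}\<rparr>"
| "apply_update (Insert_Node u) D = D\<lparr>verts := insert u (verts D)\<rparr>"
| "apply_update (Delete_Node u) D = D\<lparr>verts := verts D - {u}\<rparr>"

text \<open>
  An update keeps the relative order of the nodes present before and after it. A new node may
  be placed anywhere in the node list.
\<close>

definition updates_to :: "nat \<Rightarrow> db_rep \<Rightarrow> db_update \<Rightarrow> db_rep \<Rightarrow> bool" where
  "updates_to sigma R up R' \<longleftrightarrow>
     legal_update sigma up (db_of sigma R) \<and>
     valid_rep sigma R' \<and>
     db_of sigma R' = apply_update up (db_of sigma R) \<and>
     filter (\<lambda>u. u \<in> set (node_list R)) (node_list R') =
     filter (\<lambda>u. u \<in> set (node_list R')) (node_list R)"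

text \<open>
  Linked lists: a nonzero pointer \<open>p\<close> addresses a cell with the element at \<open>p\<close> and the pointer
  to the next cell at \<open>p + 1\<close>; \<open>0\<close> is the null pointer.
\<close>

inductive list_at :: "(nat \<Rightarrow> nat) \<Rightarrow> nat \<Rightarrow> nat list \<Rightarrow> bool" for inp where
  list_at_Nil: "list_at inp 0 []"
| list_at_Cons: "p \<noteq> 0 \<Longrightarrow> list_at inp (inp (p + 1)) xs \<Longrightarrow> list_at inp p (inp p # xs)"

text \<open>Queries are stored as the sequence of their symbols in prefix notation.\<close>

fun symbols :: "nat rpq \<Rightarrow> nat list" where
  "symbols Eps = [0]"
| "symbols (Conc r s) = 1 # symbols r @ symbols s"
| "symbols (Alt r s) = 2 # symbols r @ symbols s"
| "symbols (Plus r) = 3 # symbols r"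
| "symbols (Letter x) = [4 + x]"

text \<open>
  The input memory \<open>inp\<close> consists of \<open>w\<close>-bit words. Cell \<open>1\<close> points to the list of nodes,
  cell \<open>2\<close> to the query and cell \<open>3\<close> holds the length of the query. Cell \<open>4\<close> points to an
  array that contains, for every node \<open>u\<close> and letter \<open>x\<close>, a pointer to the list of
  \<open>x\<close>-successors of \<open>u\<close>.
\<close>

definition stores :: "nat \<Rightarrow> nat \<Rightarrow> (nat \<Rightarrow> nat) \<Rightarrow> db_rep \<Rightarrow> nat rpq \<Rightarrow> bool" where
  "stores sigma w inp R q \<longleftrightarrow>
     (\<forall>p. inp p < 2 ^ w) \<and>
     list_at inp (inp 1) (node_list R) \<and>
     (\<forall>u \<in> set (node_list R). \<forall>x < sigma.
        list_at inp (inp (inp 4 + sigma * u + x)) (succ_list R u x)) \<and>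
     inp 3 = length (symbols q) \<and>
     (\<forall>i < length (symbols q). inp (inp 2 + i) = symbols q ! i)"

text \<open>
  A program uses finitely many registers, a work memory and a read-only input memory; all
  addresses given to \<open>Read\<close>, \<open>Load\<close> and \<open>Store\<close> are contents of registers.
  Every elementary instruction and every test takes one time unit.
\<close>

datatype arith_op = Add | Sub | Mul | Div

datatype com =
    Skip
  | Const nat nat              \<comment> \<open>register := constant\<close>
  | Arith arith_op nat nat nat \<comment> \<open>target register, two operand registers\<close>
  | Read nat nat               \<comment> \<open>register := input memory at address in second register\<close>
  | Load nat nat               \<comment> \<open>register := work memory at address in second register\<close>
  | Store nat nat              \<comment> \<open>work memory at address in first register := second register\<close>
  | Output nat nat
  | Seq com com
  | If nat com com             \<comment> \<open>test whether the register is nonzero\<close>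
  | While nat com

record ram_state =
  reg :: "nat \<Rightarrow> nat"
  mem :: "nat \<Rightarrow> nat"

definition initial_state :: ram_state where
  "initial_state = \<lparr>reg = (\<lambda>_. 0), mem = (\<lambda>_. 0)\<rparr>"

fun arith :: "arith_op \<Rightarrow> nat \<Rightarrow> nat \<Rightarrow> nat" where
  "arith Add a b = a + b"
| "arith Sub a b = a - b"
| "arith Mul a b = a * b"
| "arith Div a b = a div b"

text \<open>The first argument is the word length of the machine; results are reduced modulo
  \<open>2 ^ wl\<close>. \<open>Sub\<close> is truncated subtraction on \<open>nat\<close>, so it also serves for comparisons.\<close>

definition set_reg :: "nat \<Rightarrow> nat \<Rightarrow> nat \<Rightarrow> ram_state \<Rightarrow> ram_state" where
  "set_reg wl r n s = s\<lparr>reg := (reg s)(r := n mod 2 ^ wl)\<rparr>"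

text \<open>A trace lists, for every time unit of a run, whether and what the machine outputs.\<close>

datatype event = Tick | Out "nat \<times> nat"

inductive exec ::
  "nat \<Rightarrow> (nat \<Rightarrow> nat) \<Rightarrow> com \<Rightarrow> ram_state \<Rightarrow> event list \<Rightarrow> ram_state \<Rightarrow> bool" for wl inp where
  exec_Skip: "exec wl inp Skip s [Tick] s"
| exec_Const: "exec wl inp (Const r n) s [Tick] (set_reg wl r n s)"
| exec_Arith: "exec wl inp (Arith f r a b) s [Tick] (set_reg wl r (arith f (reg s a) (reg s b)) s)"
| exec_Read: "exec wl inp (Read r a) s [Tick] (set_reg wl r (inp (reg s a)) s)"
| exec_Load: "exec wl inp (Load r a) s [Tick] (set_reg wl r (mem s (reg s a)) s)"
| exec_Store: "exec wl inp (Store a b) s [Tick] (s\<lparr>mem := (mem s)(reg s a := reg s b)\<rparr>)"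
| exec_Output: "exec wl inp (Output a b) s [Out (reg s a, reg s b)] s"
| exec_Seq: "exec wl inp c1 s tr1 s' \<Longrightarrow> exec wl inp c2 s' tr2 s'' \<Longrightarrow>
    exec wl inp (Seq c1 c2) s (tr1 @ tr2) s''"
| exec_If_True: "reg s r \<noteq> 0 \<Longrightarrow> exec wl inp c1 s tr s' \<Longrightarrow>
    exec wl inp (If r c1 c2) s (Tick # tr) s'"
| exec_If_False: "reg s r = 0 \<Longrightarrow> exec wl inp c2 s tr s' \<Longrightarrow>
    exec wl inp (If r c1 c2) s (Tick # tr) s'"
| exec_While_False: "reg s r = 0 \<Longrightarrow> exec wl inp (While r c) s [Tick] s"
| exec_While_True: "reg s r \<noteq> 0 \<Longrightarrow> exec wl inp c s tr1 s' \<Longrightarrow>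
    exec wl inp (While r c) s' tr2 s'' \<Longrightarrow>
    exec wl inp (While r c) s (Tick # tr1 @ tr2) s''"

fun outputs :: "event list \<Rightarrow> (nat \<times> nat) list" where
  "outputs [] = []"
| "outputs (Tick # es) = outputs es"
| "outputs (Out p # es) = p # outputs es"

text \<open>\<open>max_gap k es\<close>: here \<open>k\<close> is the time elapsed since the start or the last output.\<close>

fun max_gap :: "nat \<Rightarrow> event list \<Rightarrow> nat" where
  "max_gap k [] = k"
| "max_gap k (Tick # es) = max_gap (k + 1) es"
| "max_gap k (Out p # es) = max (k + 1) (max_gap 0 es)"

definition delay :: "event list \<Rightarrow> nat" where
  "delay es = max_gap 0 es"

record enum_algorithm =
  preprocess :: com
  enumerate :: com
  update_routine :: com

definition lists_sorted :: "nat \<Rightarrow> nat rpq \<Rightarrow> db_rep \<Rightarrow> event list \<Rightarrow> bool" where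
  "lists_sorted sigma q R tr \<longleftrightarrow>
     set (outputs tr) = rpq_result q (db_of sigma R) \<and>
     distinct (outputs tr) \<and>
     sorted_wrt (pair_le R) (outputs tr)"

text \<open>The update routine finds a description of the update in registers 0 to 3.\<close>

fun pass_update :: "nat \<Rightarrow> db_update \<Rightarrow> ram_state \<Rightarrow> ram_state" where
  "pass_update wl (Insert_Arc u x v) =
     set_reg wl 0 0 \<circ> set_reg wl 1 u \<circ> set_reg wl 2 x \<circ> set_reg wl 3 v"
| "pass_update wl (Delete_Arc u x v) =
     set_reg wl 0 1 \<circ> set_reg wl 1 u \<circ> set_reg wl 2 x \<circ> set_reg wl 3 v"
| "pass_update wl (Insert_Node u) = set_reg wl 0 2 \<circ> set_reg wl 1 u"
| "pass_update wl (Delete_Node u) = set_reg wl 0 3 \<circ> set_reg wl 1 u"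

text \<open>
  The situations between two phases: \<open>reachable sigma wl w A q R inp s\<close> means that after the
  preprocessing and some sequence of updates, each followed by the update routine, and of
  enumerations, in any order, the current database is \<open>R\<close>, the input memory is \<open>inp\<close> and the
  state of the machine is \<open>s\<close>. An update may replace the input memory by any other one that
  stores the updated database, in particular by one obtained through a local change of the
  lists; registers and work memory are left to the algorithm.
\<close>

inductive reachable ::
  "nat \<Rightarrow> nat \<Rightarrow> nat \<Rightarrow> enum_algorithm \<Rightarrow> nat rpq \<Rightarrow> db_rep \<Rightarrow> (nat \<Rightarrow> nat) \<Rightarrow> ram_state \<Rightarrow> bool"
  for sigma wl w A q where
  reachable_preprocess:
    "valid_rep sigma R \<Longrightarrow> stores sigma w inp R q \<Longrightarrow>
     exec wl inp (preprocess A) initial_state tr s \<Longrightarrow>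
     reachable sigma wl w A q R inp s"
| reachable_enumerate:
    "reachable sigma wl w A q R inp s \<Longrightarrow>
     exec wl inp (enumerate A) s tr s' \<Longrightarrow>
     reachable sigma wl w A q R inp s'"
| reachable_update:
    "reachable sigma wl w A q R inp s \<Longrightarrow>
     updates_to sigma R up R' \<Longrightarrow> stores sigma w inp' R' q \<Longrightarrow>
     exec wl inp' (update_routine A) (pass_update wl up s) tr s' \<Longrightarrow>
     reachable sigma wl w A q R' inp' s'"

text \<open>
  Logarithmic word size: if the input is stored in words of \<open>w\<close> bits, then the machine works
  with words of \<open>k * w\<close> bits, for a constant \<open>k\<close>. Every sufficiently large \<open>w\<close> is admitted, so
  in particular the logarithm of the number of cells of a compactly stored input. In a sequence
  of updates the word length does not change and is large enough for all databases that occur.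
\<close>

definition solves_sorted_enum ::
  "nat \<Rightarrow> nat \<Rightarrow> enum_algorithm \<Rightarrow> ((nat, nat) graph_db \<Rightarrow> nat rpq \<Rightarrow> nat) \<Rightarrow>
   ((nat, nat) graph_db \<Rightarrow> nat rpq \<Rightarrow> nat) \<Rightarrow> bool" where
  "solves_sorted_enum sigma k A delay_bound update_bound \<longleftrightarrow>
     (\<forall>w q. set_rpq q \<subseteq> {..<sigma} \<longrightarrow>
       (\<forall>R inp. valid_rep sigma R \<and> stores sigma w inp R q \<longrightarrow>
         (\<exists>tr s. exec (k * w) inp (preprocess A) initial_state tr s \<and>
            outputs tr = [] \<and> length tr \<le> delay_bound (db_of sigma R) q)) \<and>
       (\<forall>R inp s. reachable sigma (k * w) w A q R inp s \<longrightarrow>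
         (\<exists>tr s'. exec (k * w) inp (enumerate A) s tr s' \<and>
            lists_sorted sigma q R tr \<and> delay tr \<le> delay_bound (db_of sigma R) q)) \<and>
       (\<forall>R inp s up R' inp'.
         reachable sigma (k * w) w A q R inp s \<and>
         updates_to sigma R up R' \<and> stores sigma w inp' R' q \<longrightarrow>
         (\<exists>tr s'. exec (k * w) inp' (update_routine A) (pass_update (k * w) up s) tr s' \<and>
            outputs tr = [] \<and> length tr \<le> update_bound (db_of sigma R') q)))"

end

theory Submission
  imports Defs
begin

text \<open>
  Thompson's construction gives an automaton with a linear number of states and constantly many
  edges at each state, which can be tabulated from the prefix notation of the query in linear
  time. For the nodes \<open>u\<close> in order, a depth-first search in the product of database and automaton
  from \<open>u\<close> and the initial state marks the product states reached, and the answers \<open>(u, v)\<close> are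
  then listed by one pass through the node list. If the search finds no answer, its marks are kept:
  none of the states reached so far leads to a final state, so later searches need not enter them.
  Marks are cleared only after a successful search. Hence all searches between two outputs
  together visit every product state at most once, which bounds the delay by the size of the
  product. Everything is recomputed in the enumeration phase, so nothing has to be done in the
  preprocessing and after an update.
\<close>

section \<open>The automaton of a query and its product with the database\<close>

text \<open>A search costs up to the whole product, and so does clearing its marks. With a fresh
  search for every node, a long run of nodes without answers would cost an extra factor, the number
  of these nodes. Marks can be inherited because a search without answers leaves a set that is
  closed under successors and free of final states. After a successful search the marked states may
  lead to answers of the next node, so they have to go, but then an output has just restarted the
  clock. The search meets the nodes \<open>v\<close> in an order unrelated to the node list, so it
  may not output anything itself. The program may depend on \<open>sigma\<close> but not on the
  query, hence the machine has to compute the automaton. Nodes are arbitrary numbers below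
  \<open>2 ^ w\<close>: the product states are scattered among cells whose number is of order
  \<open>2 ^ (2 * w)\<close> and whose content at the start of an enumeration is unknown. Clearing
  therefore follows the node list instead of sweeping memory.\<close>

definition lconc :: "'a list set \<Rightarrow> 'a list set \<Rightarrow> 'a list set" where
  "lconc A B = {xs @ ys | xs ys. xs \<in> A \<and> ys \<in> B}"

definition lstar :: "'a list set \<Rightarrow> 'a list set" where
  "lstar A = {concat ws | ws. set ws \<subseteq> A}"

lemma lconcI: "xs \<in> A \<Longrightarrow> ys \<in> B \<Longrightarrow> xs @ ys \<in> lconc A B"
  by (auto simp: lconc_def)

lemma lconc_assoc: "lconc (lconc A B) C = lconc A (lconc B C)"
  unfolding lconc_def
  apply (intro set_eqI iffI)
   apply clarsimp
   apply (metis append_assoc)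
  apply clarsimp
  by (metis append_assoc)

lemma lconc_Nil [simp]: "lconc {[]} B = B" "lconc B {[]} = B"
  by (auto simp: lconc_def)

lemma lconc_Un: "lconc (A \<union> B) C = lconc A C \<union> lconc B C"
  by (auto simp: lconc_def)

lemma lang_Conc_lconc: "lang (Conc r s) = lconc (lang r) (lang s)"
  by (simp add: lconc_def)

lemma lang_Plus_lstar: "lang (Plus r) = lconc (lang r) (lstar (lang r))"
proof (intro set_eqI iffI)
  fix x assume "x \<in> lang (Plus r)"
  then obtain ws where ws: "x = concat ws" "ws \<noteq> []" "set ws \<subseteq> lang r" by auto
  then obtain y ys where "ws = y # ys" by (cases ws) auto
  with ws show "x \<in> lconc (lang r) (lstar (lang r))"
    by (auto simp: lstar_def intro!: lconcI)
next
  fix x assume "x \<in> lconc (lang r) (lstar (lang r))"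
  then obtain y ws where "x = y @ concat ws" "y \<in> lang r" "set ws \<subseteq> lang r"
    by (auto simp: lconc_def lstar_def)
  then show "x \<in> lang (Plus r)"
    by (auto intro!: exI[of _ "y # ws"])
qed

lemma lstar_unfold: "lstar A = {[]} \<union> lconc A (lstar A)"
proof (intro set_eqI iffI)
  fix x assume "x \<in> lstar A"
  then obtain ws where ws: "x = concat ws" "set ws \<subseteq> A" by (auto simp: lstar_def)
  then show "x \<in> {[]} \<union> lconc A (lstar A)"
    by (cases ws) (auto simp: lstar_def intro!: lconcI)
next
  fix x assume "x \<in> {[]} \<union> lconc A (lstar A)"
  then show "x \<in> lstar A"
  proof
    assume "x \<in> {[]}" then show ?thesis by (auto simp: lstar_def intro!: exI[of _ "[]"])
  next
    assume "x \<in> lconc A (lstar A)"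
    then obtain y ws where "x = y @ concat ws" "y \<in> A" "set ws \<subseteq> A"
      by (auto simp: lconc_def lstar_def)
    then show ?thesis by (auto simp: lstar_def intro!: exI[of _ "y # ws"])
  qed
qed

text \<open>For \<open>xs = []\<close> the right-hand side demands \<open>u \<in> verts D\<close>; a
  path that starts with an arc supplies this only because the endpoints of arcs are nodes.\<close>

lemma path_append:
  "path D u (xs @ ys) v \<longleftrightarrow> (\<exists>w. path D u xs w \<and> path D w ys v)" if "arcs D \<subseteq> verts D \<times> UNIV \<times> verts D"
proof (induction xs arbitrary: u)
  case Nil
  have "path D u ys v \<Longrightarrow> u \<in> verts D"
    by (erule path.cases) (use that in auto)
  then show ?case by (auto intro: path_Nil elim: path.cases)
next
  case (Cons a xs)
  have *: "path D u (a # zs) v \<longleftrightarrow> (\<exists>w. (u, a, w) \<in> arcs D \<and> path D w zs v)" for zs v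
    by (auto intro: path_Cons elim: path.cases)
  show ?case using Cons by (auto simp: *)
qed

text \<open>
  A position \<open>i\<close> of \<open>symbols q\<close> stands for the subexpression that starts there. It is also a
  state of the automaton, \<open>n = length (symbols q)\<close> is the final state, and \<open>n + 1 + i\<close> is the
  state entered after each round of an iterated subexpression \<open>Plus r\<close> at \<open>i\<close>. The list
  \<open>nodes\<close> contains for every position the subexpression, the state in which the automaton
  continues after it, and the language accepted from that state.
\<close>

fun nodes :: "nat \<Rightarrow> nat \<Rightarrow> nat \<Rightarrow> 'a list set \<Rightarrow> 'a rpq \<Rightarrow> ('a rpq \<times> nat \<times> 'a list set) list" where
  "nodes n i c K Eps = [(Eps, c, K)]"
| "nodes n i c K (Letter x) = [(Letter x, c, K)]"
| "nodes n i c K (Conc r s) = (Conc r s, c, K) #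
     nodes n (i + 1) (i + 1 + rpq_length r) (lconc (lang s) K) r @
     nodes n (i + 1 + rpq_length r) c K s"
| "nodes n i c K (Alt r s) = (Alt r s, c, K) #
     nodes n (i + 1) c K r @ nodes n (i + 1 + rpq_length r) c K s"
| "nodes n i c K (Plus r) = (Plus r, c, K) #
     nodes n (i + 1) (n + 1 + i) (lconc (lstar (lang r)) K) r"

lemma length_nodes [simp]: "length (nodes n i c K r) = rpq_length r"
  by (induction r arbitrary: i c K) auto

lemma length_symbols [simp]: "length (symbols r) = rpq_length r"
  by (induction r) auto

lemma rpq_length_pos [simp]: "rpq_length r > 0"
  by (cases r) auto

lemma nodes_hd: "nodes n i c K r ! 0 = (r, c, K)"
  by (cases r) auto

text \<open>A subexpression occupies a contiguous block of the prefix notation, and the recursion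
  hands it nothing but its offset, its continuation and the language of that continuation. So facts
  about the neighbours of a position can be read off one unfolding of \<open>nodes\<close> at that
  position.\<close>

lemma nodes_split:
  assumes "j < rpq_length q" "nodes n i c K q ! j = (r, d, L)"
  shows "\<exists>pre suf. nodes n i c K q = pre @ nodes n (i + j) d L r @ suf \<and> length pre = j"
  using assms
proof (induction q arbitrary: i j c K)
  case Eps then show ?case by auto
next
  case (Letter x) then show ?case by auto
next
  case (Conc r1 r2)
  show ?case
  proof (cases j)
    case 0
    then show ?thesis using Conc.prems by auto
  next
    case (Suc j')
    show ?thesis
    proof (cases "j' < rpq_length r1")
      case True
      then have "nodes n (i + 1) (i + 1 + rpq_length r1) (lconc (lang r2) K) r1 ! j' = (r, d, L)"
        using Conc.prems Suc by (auto simp: nth_append)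
      from Conc.IH(1)[OF True this] obtain pre suf where
        "nodes n (i + 1) (i + 1 + rpq_length r1) (lconc (lang r2) K) r1 =
           pre @ nodes n (i + 1 + j') d L r @ suf" "length pre = j'"
        by blast
      then show ?thesis using Suc
        by (intro exI[of _ "(Conc r1 r2, c, K) # pre"] exI[of _ "suf @ nodes n (i + 1 + rpq_length r1) c K r2"]) auto
    next
      case False
      define l where "l = j' - rpq_length r1"
      have l: "l < rpq_length r2" "j' = rpq_length r1 + l" using False Conc.prems Suc
        by (auto simp: l_def)
      then have "nodes n (i + 1 + rpq_length r1) c K r2 ! l = (r, d, L)"
        using Conc.prems Suc by (auto simp: nth_append)
      from Conc.IH(2)[OF l(1) this] obtain pre suf where
        "nodes n (i + 1 + rpq_length r1) c K r2 =
           pre @ nodes n (i + 1 + rpq_length r1 + l) d L r @ suf" "length pre = l"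
        by blast
      then show ?thesis using Suc l
        by (intro exI[of _ "(Conc r1 r2, c, K) #
              nodes n (i + 1) (i + 1 + rpq_length r1) (lconc (lang r2) K) r1 @ pre"] exI[of _ suf])
          (auto simp: add.assoc)
    qed
  qed
next
  case (Alt r1 r2)
  show ?case
  proof (cases j)
    case 0
    then show ?thesis using Alt.prems by auto
  next
    case (Suc j')
    show ?thesis
    proof (cases "j' < rpq_length r1")
      case True
      then have "nodes n (i + 1) c K r1 ! j' = (r, d, L)"
        using Alt.prems Suc by (auto simp: nth_append)
      from Alt.IH(1)[OF True this] obtain pre suf where
        "nodes n (i + 1) c K r1 = pre @ nodes n (i + 1 + j') d L r @ suf" "length pre = j'"
        by blast
      then show ?thesis using Suc
        by (intro exI[of _ "(Alt r1 r2, c, K) # pre"] exI[of _ "suf @ nodes n (i + 1 + rpq_length r1) c K r2"]) auto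
    next
      case False
      define l where "l = j' - rpq_length r1"
      have l: "l < rpq_length r2" "j' = rpq_length r1 + l" using False Alt.prems Suc
        by (auto simp: l_def)
      then have "nodes n (i + 1 + rpq_length r1) c K r2 ! l = (r, d, L)"
        using Alt.prems Suc by (auto simp: nth_append)
      from Alt.IH(2)[OF l(1) this] obtain pre suf where
        "nodes n (i + 1 + rpq_length r1) c K r2 =
           pre @ nodes n (i + 1 + rpq_length r1 + l) d L r @ suf" "length pre = l"
        by blast
      then show ?thesis using Suc l
        by (intro exI[of _ "(Alt r1 r2, c, K) # nodes n (i + 1) c K r1 @ pre"] exI[of _ suf])
          (auto simp: add.assoc)
    qed
  qed
next
  case (Plus q)
  show ?case
  proof (cases j)
    case 0
    then show ?thesis using Plus.prems by auto
  next
    case (Suc j')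
    with Plus.prems have "j' < rpq_length q"
      "nodes n (i + 1) (n + 1 + i) (lconc (lstar (lang q)) K) q ! j' = (r, d, L)" by auto
    from Plus.IH[OF this] obtain pre suf where
      "nodes n (i + 1) (n + 1 + i) (lconc (lstar (lang q)) K) q =
         pre @ nodes n (i + 1 + j') d L r @ suf" "length pre = j'"
      by blast
    then show ?thesis using Suc
      by (intro exI[of _ "(Plus q, c, K) # pre"] exI[of _ suf]) auto
  qed
qed

lemma nodes_sub:
  assumes "j < rpq_length q" "nodes n i c K q ! j = (r, d, L)"
  shows "j + rpq_length r \<le> rpq_length q"
    and "l < rpq_length r \<Longrightarrow> nodes n i c K q ! (j + l) = nodes n (i + j) d L r ! l"
proof -
  obtain pre suf where *: "nodes n i c K q = pre @ nodes n (i + j) d L r @ suf" "length pre = j"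
    using nodes_split[OF assms] by blast
  have "rpq_length q = length (nodes n i c K q)" by simp
  also have "\<dots> = j + rpq_length r + length suf" unfolding *(1) using *(2) by simp
  finally show "j + rpq_length r \<le> rpq_length q" by simp
  show "l < rpq_length r \<Longrightarrow> nodes n i c K q ! (j + l) = nodes n (i + j) d L r ! l"
    using * by (auto simp: nth_append)
qed

fun sym :: "nat rpq \<Rightarrow> nat" where
  "sym Eps = 0"
| "sym (Conc r s) = 1"
| "sym (Alt r s) = 2"
| "sym (Plus r) = 3"
| "sym (Letter x) = 4 + x"

lemma symbols_nodes: "symbols q = map (\<lambda>(r, c, K). sym r) (nodes n i c K q)"
  by (induction q arbitrary: i c K) auto

text \<open>Continuations are handed down from parents to children. Parents stand to the left of
  their children, so this gives induction over positions and, later, the correctness of filling the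
  table from left to right.\<close>

lemma nodes_parent:
  assumes "0 < j" "j < rpq_length q"
  shows "\<exists>p < j. (\<exists>a b. fst (nodes n i c K q ! p) \<in> {Conc a b, Alt a b} \<and>
             (j = p + 1 \<or> j = p + 1 + rpq_length a)) \<or>
           (\<exists>a. fst (nodes n i c K q ! p) = Plus a \<and> j = p + 1)"
    (is "\<exists>p < j. ?P n i c K q p j")
  using assms
proof (induction q arbitrary: i j c K)
  case Eps then show ?case by auto
next
  case (Letter x) then show ?case by auto
next
  case (Conc r1 r2)
  consider "j = 1" | "1 < j" "j < 1 + rpq_length r1" | "j = 1 + rpq_length r1" | "j > 1 + rpq_length r1"
    using Conc.prems by linarith
  then show ?case
  proof cases
    case 1
    then show ?thesis by (intro exI[of _ 0]) auto
  next
    case 2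
    then have "0 < j - 1" "j - 1 < rpq_length r1" by auto
    from Conc.IH(1)[OF this] obtain p where "p < j - 1"
      "?P n (i + 1) (i + 1 + rpq_length r1) (lconc (lang r2) K) r1 p (j - 1)" by blast
    moreover have "p < rpq_length r1" using calculation 2 by linarith
    ultimately show ?thesis using 2
      by (intro exI[of _ "p + 1"]) (auto simp: nth_append)
  next
    case 3
    then show ?thesis by (intro exI[of _ 0]) auto
  next
    case 4
    define l where "l = j - (1 + rpq_length r1)"
    have l: "j = l + (1 + rpq_length r1)" "0 < l" "l < rpq_length r2"
      using 4 Conc.prems by (auto simp: l_def)
    from Conc.IH(2)[OF l(2,3)] obtain p where "p < l"
      "?P n (i + 1 + rpq_length r1) c K r2 p l" by blast
    then show ?thesis using l
      by (intro exI[of _ "p + (1 + rpq_length r1)"]) (auto simp: nth_append)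
  qed
next
  case (Alt r1 r2)
  consider "j = 1" | "1 < j" "j < 1 + rpq_length r1" | "j = 1 + rpq_length r1" | "j > 1 + rpq_length r1"
    using Alt.prems by linarith
  then show ?case
  proof cases
    case 1
    then show ?thesis by (intro exI[of _ 0]) auto
  next
    case 2
    then have "0 < j - 1" "j - 1 < rpq_length r1" by auto
    from Alt.IH(1)[OF this] obtain p where "p < j - 1" "?P n (i + 1) c K r1 p (j - 1)" by blast
    moreover have "p < rpq_length r1" using calculation 2 by linarith
    ultimately show ?thesis using 2
      by (intro exI[of _ "p + 1"]) (auto simp: nth_append)
  next
    case 3
    then show ?thesis by (intro exI[of _ 0]) auto
  next
    case 4
    define l where "l = j - (1 + rpq_length r1)"
    have l: "j = l + (1 + rpq_length r1)" "0 < l" "l < rpq_length r2"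
      using 4 Alt.prems by (auto simp: l_def)
    from Alt.IH(2)[OF l(2,3)] obtain p where "p < l"
      "?P n (i + 1 + rpq_length r1) c K r2 p l" by blast
    then show ?thesis using l
      by (intro exI[of _ "p + (1 + rpq_length r1)"]) (auto simp: nth_append)
  qed
next
  case (Plus q)
  show ?case
  proof (cases "j = 1")
    case True
    then show ?thesis by (intro exI[of _ 0]) auto
  next
    case False
    then have "0 < j - 1" "j - 1 < rpq_length q" using Plus.prems by auto
    from Plus.IH[OF this] obtain p where "p < j - 1"
      "?P n (i + 1) (n + 1 + i) (lconc (lstar (lang q)) K) q p (j - 1)" by blast
    then show ?thesis using False
      by (intro exI[of _ "p + 1"]) auto
  qed
qed

section \<open>The table of positions of the whole query\<close>

definition node_at :: "'a rpq \<Rightarrow> nat \<Rightarrow> 'a rpq \<times> nat \<times> 'a list set" where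
  "node_at q i = nodes (rpq_length q) 0 (rpq_length q) {[]} q ! i"

definition sub_at :: "'a rpq \<Rightarrow> nat \<Rightarrow> 'a rpq" where
  "sub_at q i = fst (node_at q i)"

definition cont_at :: "'a rpq \<Rightarrow> nat \<Rightarrow> nat" where
  "cont_at q i = fst (snd (node_at q i))"

definition res_at :: "'a rpq \<Rightarrow> nat \<Rightarrow> 'a list set" where
  "res_at q i = snd (snd (node_at q i))"

definition end_at :: "'a rpq \<Rightarrow> nat \<Rightarrow> nat" where
  "end_at q i = i + rpq_length (sub_at q i)"

lemma sub_at_0: "sub_at q 0 = q" "cont_at q 0 = rpq_length q" "res_at q 0 = {[]}"
  by (simp_all add: sub_at_def cont_at_def res_at_def node_at_def nodes_hd)

lemma end_at_le: "i < rpq_length q \<Longrightarrow> end_at q i \<le> rpq_length q"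
  using nodes_sub(1)[of i q "rpq_length q" 0 "rpq_length q" "{[]}"]
  by (simp add: end_at_def sub_at_def node_at_def prod_eq_iff)

lemma node_at_sub:
  assumes "i < rpq_length q" "l < rpq_length (sub_at q i)"
  shows "node_at q (i + l) = nodes (rpq_length q) i (cont_at q i) (res_at q i) (sub_at q i) ! l"
  using nodes_sub(2)[of i q "rpq_length q" 0 "rpq_length q" "{[]}" "sub_at q i" "cont_at q i" "res_at q i" l] assms
  by (simp add: sub_at_def cont_at_def res_at_def node_at_def)

lemma node_at_Conc:
  assumes "i < rpq_length q" "sub_at q i = Conc a b"
  shows "node_at q (i + 1) = (a, i + 1 + rpq_length a, lconc (lang b) (res_at q i))"
    "node_at q (i + 1 + rpq_length a) = (b, cont_at q i, res_at q i)"
    "end_at q i = i + 1 + rpq_length a + rpq_length b"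
  using node_at_sub[OF assms(1), of 1] node_at_sub[OF assms(1), of "1 + rpq_length a"] assms(2)
  by (auto simp: nth_append nodes_hd add.assoc end_at_def)

lemma node_at_Alt:
  assumes "i < rpq_length q" "sub_at q i = Alt a b"
  shows "node_at q (i + 1) = (a, cont_at q i, res_at q i)"
    "node_at q (i + 1 + rpq_length a) = (b, cont_at q i, res_at q i)"
    "end_at q i = i + 1 + rpq_length a + rpq_length b"
  using node_at_sub[OF assms(1), of 1] node_at_sub[OF assms(1), of "1 + rpq_length a"] assms(2)
  by (auto simp: nth_append nodes_hd add.assoc end_at_def)

lemma node_at_Plus:
  assumes "i < rpq_length q" "sub_at q i = Plus a"
  shows "node_at q (i + 1) = (a, rpq_length q + 1 + i, lconc (lstar (lang a)) (res_at q i))"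
    "end_at q i = i + 1 + rpq_length a"
  using node_at_sub[OF assms(1), of 1] assms(2)
  by (auto simp: nodes_hd end_at_def)

lemma symbols_nth: "i < rpq_length q \<Longrightarrow> symbols q ! i = sym (sub_at q i)"
  by (subst symbols_nodes[of _ "rpq_length q" 0 "rpq_length q" "{[]}"])
    (simp add: sub_at_def node_at_def split_beta)

lemma set_rpq_nodes: "x \<in> set (nodes n i c K q) \<Longrightarrow> set_rpq (fst x) \<subseteq> set_rpq q"
  by (induction q arbitrary: i c K) (simp, simp, fastforce+)

lemma set_rpq_sub_at: "i < rpq_length q \<Longrightarrow> set_rpq (sub_at q i) \<subseteq> set_rpq q"
  unfolding sub_at_def node_at_def by (rule set_rpq_nodes, rule nth_mem) simp

lemma parent_at:
  assumes "0 < j" "j < rpq_length q"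
  obtains (Binary) p a b where "p < j" "sub_at q p = Conc a b \<or> sub_at q p = Alt a b"
      "j = p + 1 \<or> j = p + 1 + rpq_length a"
  | (Unary) p a where "p < j" "sub_at q p = Plus a" "j = p + 1"
  using nodes_parent[OF assms, of "rpq_length q" 0 "rpq_length q" "{[]}"]
  unfolding sub_at_def node_at_def by auto

text \<open>
  Here and in \<open>psucc\<close>, the states \<open>n + 1 + i\<close> for positions \<open>i\<close> of subexpressions other than
  \<open>Plus r\<close> are treated alike; they are never reached.
\<close>

definition state_lang :: "'a rpq \<Rightarrow> nat \<Rightarrow> 'a list set" where
  "state_lang q s =
     (let n = rpq_length q;
          L = (\<lambda>i. if i < n then lconc (lang (sub_at q i)) (res_at q i) else {[]})
      in if s \<le> n then L s else L (s - n) \<union> res_at q (s - n - 1))"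

text \<open>Induction from parent to child. Most cases copy or compose languages; the exception is
  the operand of \<open>Plus a\<close>. The state entered after a round offers another round or the
  exit, and \<open>lstar_unfold\<close> shows that these two options together amount to
  \<open>lstar (lang a)\<close> followed by the language of the exit.\<close>

lemma cont_at_lang:
  "i < rpq_length q \<Longrightarrow> cont_at q i \<le> 2 * rpq_length q \<and> state_lang q (cont_at q i) = res_at q i"
proof (induction i rule: less_induct)
  case (less j)
  show ?case
  proof (cases "j = 0")
    case True
    then show ?thesis by (simp add: sub_at_0 state_lang_def)
  next
    case False
    with less.prems have "0 < j" "j < rpq_length q" by auto
    then show ?thesis
    proof (cases rule: parent_at)
      case (Binary p a b)
      then have p: "p < rpq_length q" using less.prems by simp
      note IH = less.IH[OF Binary(1) p]
      from Binary(2) show ?thesis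
      proof
        assume C: "sub_at q p = Conc a b"
        have len: "p + 1 + rpq_length a < rpq_length q"
          using end_at_le[OF p] node_at_Conc(3)[OF p C] rpq_length_pos[of b] by linarith
        from Binary(3) show ?thesis
        proof
          assume "j = p + 1"
          then show ?thesis using node_at_Conc[OF p C] len
            by (auto simp: cont_at_def res_at_def sub_at_def state_lang_def)
        next
          assume "j = p + 1 + rpq_length a"
          then show ?thesis using node_at_Conc[OF p C] len IH
            by (auto simp: cont_at_def res_at_def)
        qed
      next
        assume C: "sub_at q p = Alt a b"
        from Binary(3) show ?thesis
          using node_at_Alt[OF p C] IH by (auto simp: cont_at_def res_at_def)
      qed
    next
      case (Unary p a)
      then have p: "p < rpq_length q" using less.prems by simp
      note IH = less.IH[OF Unary(1) p]
      have len: "p + 1 < rpq_length q"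
        using end_at_le[OF p] node_at_Plus(2)[OF p Unary(2)] rpq_length_pos[of a] by linarith
      have "lconc (lang a) (lconc (lstar (lang a)) (res_at q p)) \<union> res_at q p =
        lconc (lstar (lang a)) (res_at q p)"
        using arg_cong[OF lstar_unfold[of "lang a"], of "\<lambda>A. lconc A (res_at q p)"]
        by (simp only: lconc_Un lconc_assoc lconc_Nil) blast
      then show ?thesis using node_at_Plus[OF p Unary(2)] len Unary(3)
        by (auto simp: cont_at_def res_at_def sub_at_def state_lang_def)
    qed
  qed
qed

section \<open>The product graph: soundness and completeness of reachability\<close>

definition psucc :: "db_rep \<Rightarrow> nat rpq \<Rightarrow> nat \<times> nat \<Rightarrow> (nat \<times> nat) list" where
  "psucc R q = (\<lambda>(u, s). let n = rpq_length q in
     if s < n then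
       (case sub_at q s of
          Eps \<Rightarrow> [(u, cont_at q s)]
        | Letter x \<Rightarrow> map (\<lambda>v. (v, cont_at q s)) (succ_list R u x)
        | Conc a b \<Rightarrow> [(u, s + 1)]
        | Alt a b \<Rightarrow> [(u, s + 1), (u, s + 1 + rpq_length a)]
        | Plus a \<Rightarrow> [(u, s + 1)])
     else if s = n then []
     else [(u, s - n), (u, cont_at q (s - n - 1))])"

definition prel :: "db_rep \<Rightarrow> nat rpq \<Rightarrow> ((nat \<times> nat) \<times> (nat \<times> nat)) set" where
  "prel R q = {(x, y). y \<in> set (psucc R q x)}"

lemma prel_iff: "(x, y) \<in> prel R q \<longleftrightarrow> y \<in> set (psucc R q x)"
  by (simp add: prel_def)

definition pstates :: "db_rep \<Rightarrow> nat rpq \<Rightarrow> (nat \<times> nat) set" where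
  "pstates R q = set (node_list R) \<times> {..2 * rpq_length q}"

locale product =
  fixes sigma :: nat and R :: db_rep and q :: "nat rpq"
  assumes valid: "valid_rep sigma R"
    and letters: "set_rpq q \<subseteq> {..<sigma}"
begin

abbreviation "n \<equiv> rpq_length q"
abbreviation "D \<equiv> db_of sigma R"

lemma letter_less: "i < n \<Longrightarrow> sub_at q i = Letter x \<Longrightarrow> x < sigma"
  using set_rpq_sub_at[of i q] letters by auto

lemma arcs_db_of: "arcs D \<subseteq> verts D \<times> UNIV \<times> verts D"
  using valid by (auto simp: db_of_def valid_rep_def)

lemma cont_at_le: "i < n \<Longrightarrow> cont_at q i \<le> 2 * n"
  using cont_at_lang[of i q] by simp

lemma Conc_less: "i < n \<Longrightarrow> sub_at q i = Conc a b \<Longrightarrow> i + 1 + rpq_length a < n"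
  using end_at_le[of i q] node_at_Conc(3)[of i q a b] rpq_length_pos[of b] by linarith

lemma Alt_less: "i < n \<Longrightarrow> sub_at q i = Alt a b \<Longrightarrow> i + 1 + rpq_length a < n"
  using end_at_le[of i q] node_at_Alt(3)[of i q a b] rpq_length_pos[of b] by linarith

lemma Plus_less: "i < n \<Longrightarrow> sub_at q i = Plus a \<Longrightarrow> i + 1 < n"
  using end_at_le[of i q] node_at_Plus(2)[of i q a] rpq_length_pos[of a] by linarith

lemma psucc_pstates:
  assumes "x \<in> pstates R q"
  shows "set (psucc R q x) \<subseteq> pstates R q"
proof -
  obtain u s where x: "x = (u, s)" "u \<in> set (node_list R)" "s \<le> 2 * n"
    using assms by (auto simp: pstates_def)
  show ?thesis
  proof (cases "s < n")
    case True
    have l: "a < sigma \<Longrightarrow> set (succ_list R u a) \<subseteq> set (node_list R)" for a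
      using valid x(2) by (auto simp: valid_rep_def)
    show ?thesis
      using True x cont_at_le[OF True] letter_less[OF True] l Alt_less[OF True]
      by (auto simp: psucc_def pstates_def Let_def split: rpq.splits)
  next
    case False
    then show ?thesis using x cont_at_le[of "s - n - 1"]
      by (auto simp: psucc_def pstates_def Let_def)
  qed
qed

text \<open>A walk in the product comes with no decomposition along subexpressions, so soundness is
  proved edge by edge, backwards, through the languages accepted from the states.\<close>

lemma psucc_lang:
  assumes "s \<le> 2 * n" "(v, t) \<in> set (psucc R q (u, s))" "u \<in> verts D"
    "bs \<in> state_lang q t" "path D v bs w"
  shows "\<exists>as \<in> state_lang q s. path D u as w"
proof -
  have "s \<noteq> n" using assms(2) by (auto simp: psucc_def)
  then consider (main) "s < n" | (loop) "n < s" by linarith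
  then show ?thesis
  proof cases
    case main
    have SL: "state_lang q s = lconc (lang (sub_at q s)) (res_at q s)"
      using main by (simp add: state_lang_def)
    have CL: "state_lang q (cont_at q s) = res_at q s" using cont_at_lang main by blast
    show ?thesis
    proof (cases "sub_at q s")
      case Eps
      then have "v = u" "t = cont_at q s" using assms(2) main by (simp_all add: psucc_def)
      moreover have "state_lang q s = res_at q s" using SL Eps by simp
      ultimately show ?thesis using assms(4,5) CL by blast
    next
      case (Letter x)
      then have "(u, x, v) \<in> arcs D" "t = cont_at q s"
        using assms(2,3) letter_less[OF main Letter] main Letter
        by (auto simp: psucc_def db_of_def)
      moreover have "x # bs \<in> state_lang q s"
        using Letter SL CL assms(4) \<open>t = cont_at q s\<close> lconcI[of "[x]" "{[x]}" bs] by simp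
      moreover have "path D u (x # bs) w" using calculation(1) assms(5) by (rule path_Cons)
      ultimately show ?thesis by blast
    next
      case (Conc a b)
      then have "state_lang q t = state_lang q s" "v = u"
        using assms(2) SL main node_at_Conc[OF main Conc] Conc_less[OF main Conc]
        by (auto simp: psucc_def state_lang_def sub_at_def res_at_def lang_Conc_lconc lconc_assoc
            simp del: lang.simps)
      then show ?thesis using assms by blast
    next
      case (Alt a b)
      then have "state_lang q t \<subseteq> state_lang q s \<and> v = u"
        using assms(2) SL main node_at_Alt[OF main Alt] Alt_less[OF main Alt]
        by (auto simp: psucc_def state_lang_def sub_at_def res_at_def lconc_Un)
      then show ?thesis using assms by blast
    next
      case (Plus a)
      then have "state_lang q t = state_lang q s" "v = u"
        using assms(2) SL main node_at_Plus[OF main Plus] Plus_less[OF main Plus]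
        by (auto simp: psucc_def state_lang_def sub_at_def res_at_def lang_Plus_lstar lconc_assoc
            simp del: lang.simps)
      then show ?thesis using assms by blast
    qed
  next
    case loop
    define i where "i = s - n - 1"
    have i: "s = n + 1 + i" "i < n" using loop assms(1) by (auto simp: i_def)
    have "v = u" "t = i + 1 \<or> t = cont_at q i"
      using assms(2) i(2) unfolding i(1) by (auto simp: psucc_def Let_def)
    moreover have "state_lang q s = state_lang q (i + 1) \<union> state_lang q (cont_at q i)"
      using cont_at_lang[OF i(2)] i(2) unfolding i(1) by (simp add: state_lang_def)
    ultimately show ?thesis using assms(4,5) by blast
  qed
qed

lemma reach_imp_path:
  assumes "((u, s), (v, n)) \<in> (prel R q)\<^sup>*" "(u, s) \<in> pstates R q"
  shows "\<exists>as \<in> state_lang q s. path D u as v"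
  using assms
proof (induction "(u, s)" arbitrary: u s rule: converse_rtrancl_induct)
  case base
  then have "path D v [] v" by (auto simp: pstates_def db_of_def intro: path_Nil)
  then show ?case by (auto simp: state_lang_def)
next
  case (step z)
  obtain v' t where z: "z = (v', t)" by fastforce
  have "(v', t) \<in> set (psucc R q (u, s))" using step z by (auto simp: prel_def)
  moreover have "(v', t) \<in> pstates R q" using calculation psucc_pstates step.prems by blast
  then obtain as where "as \<in> state_lang q t" "path D v' as v" using step z by blast
  ultimately show ?case using psucc_lang[of s v' t u as v] step.prems
    by (auto simp: pstates_def db_of_def)
qed

text \<open>In this direction the word is already decomposed, so induction on the subexpression
  works: the walk goes from the position to its continuation, and for \<open>Conc\<close> the two
  walks meet at the position of the second operand.\<close>

lemma path_imp_reach: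
  assumes "i < n" "as \<in> lang (sub_at q i)" "path D u as v"
  shows "((u, i), (v, cont_at q i)) \<in> (prel R q)\<^sup>*"
  using assms
proof (induction "sub_at q i" arbitrary: i as u v)
  case Eps
  then have "as = []" by (auto simp flip: Eps(1))
  then have "v = u" using Eps(4) by (auto elim: path.cases)
  then show ?case using Eps(1)[symmetric] Eps(2-)
    by (intro r_into_rtrancl) (auto simp: prel_iff psucc_def)
next
  case (Letter x)
  then have "as = [x]" by (auto simp flip: Letter(1))
  then have "(u, x, v) \<in> arcs D" using Letter(4) by (auto elim!: path.cases)
  then show ?case using Letter(1)[symmetric] Letter(2-)
    by (intro r_into_rtrancl) (auto simp: prel_iff psucc_def db_of_def)
next
  case (Conc a b)
  note C = Conc(3)[symmetric]
  obtain xs ys where "as = xs @ ys" "xs \<in> lang a" "ys \<in> lang b"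
    using Conc(5) unfolding C by auto
  moreover obtain w where "path D u xs w" "path D w ys v"
    using Conc(6) calculation(1) path_append[OF arcs_db_of] by blast
  moreover have "((u, i), (u, i + 1)) \<in> prel R q"
    using C Conc(4) by (auto simp: prel_iff psucc_def)
  moreover have "((u, i + 1), (w, i + 1 + rpq_length a)) \<in> (prel R q)\<^sup>*"
    using Conc(1)[of "i + 1" xs u w] calculation node_at_Conc[OF Conc(4) C] Conc_less[OF Conc(4) C]
    by (auto simp: sub_at_def cont_at_def)
  moreover have "((w, i + 1 + rpq_length a), (v, cont_at q i)) \<in> (prel R q)\<^sup>*"
    using Conc(2)[of "i + 1 + rpq_length a" ys w v] calculation node_at_Conc[OF Conc(4) C]
      Conc_less[OF Conc(4) C]
    by (auto simp: sub_at_def cont_at_def)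
  ultimately show ?case by (meson converse_rtrancl_into_rtrancl rtrancl_trans)
next
  case (Alt a b)
  note C = Alt(3)[symmetric]
  from Alt(5) consider "as \<in> lang a" | "as \<in> lang b" unfolding C by auto
  then show ?case
  proof cases
    case 1
    have "((u, i), (u, i + 1)) \<in> prel R q"
      using C Alt(4) by (auto simp: prel_iff psucc_def)
    moreover have "((u, i + 1), (v, cont_at q i)) \<in> (prel R q)\<^sup>*"
      using Alt(1)[of "i + 1" as u v] 1 Alt(6) node_at_Alt[OF Alt(4) C] Alt_less[OF Alt(4) C]
      by (auto simp: sub_at_def cont_at_def)
    ultimately show ?thesis by (rule converse_rtrancl_into_rtrancl)
  next
    case 2
    have "((u, i), (u, i + 1 + rpq_length a)) \<in> prel R q"
      using C Alt(4) by (auto simp: prel_iff psucc_def)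
    moreover have "((u, i + 1 + rpq_length a), (v, cont_at q i)) \<in> (prel R q)\<^sup>*"
      using Alt(2)[of "i + 1 + rpq_length a" as u v] 2 Alt(6) node_at_Alt[OF Alt(4) C]
        Alt_less[OF Alt(4) C]
      by (auto simp: sub_at_def cont_at_def)
    ultimately show ?thesis by (rule converse_rtrancl_into_rtrancl)
  qed
next
  case (Plus a)
  note C = Plus(2)[symmetric]
  note less = Plus_less[OF Plus(3) C]
  note nd = node_at_Plus[OF Plus(3) C]
  have round: "((u, i + 1), (v, n + 1 + i)) \<in> (prel R q)\<^sup>*" if "as \<in> lang a" "path D u as v" for as u v
    using Plus(1)[of "i + 1" as u v] that nd less by (auto simp: sub_at_def cont_at_def)
  \<comment> \<open>Only the first round starts in the state \<open>i\<close>. All later ones start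
    and end in \<open>n + 1 + i\<close>, so they can be chained by induction on the list of
    words.\<close>
  have rounds: "((u, n + 1 + i), (v, n + 1 + i)) \<in> (prel R q)\<^sup>*"
    if "set ws \<subseteq> lang a" "path D u (concat ws) v" for ws u v
    using that
  proof (induction ws arbitrary: u)
    case Nil
    then show ?case by (auto elim: path.cases)
  next
    case (Cons x ws)
    then obtain w where w: "path D u x w" "path D w (concat ws) v"
      using path_append[OF arcs_db_of] by auto
    have "((u, n + 1 + i), (u, i + 1)) \<in> prel R q"
      by (auto simp: prel_iff psucc_def Let_def)
    moreover have "((u, i + 1), (w, n + 1 + i)) \<in> (prel R q)\<^sup>*"
      using round Cons.prems w by auto
    moreover have "((w, n + 1 + i), (v, n + 1 + i)) \<in> (prel R q)\<^sup>*"
      using Cons w by auto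
    ultimately show ?case by (meson converse_rtrancl_into_rtrancl rtrancl_trans)
  qed
  obtain xs ws where "as = xs @ concat ws" "xs \<in> lang a" "set ws \<subseteq> lang a"
    using Plus(4) unfolding C lang_Plus_lstar lconc_def lstar_def by auto
  moreover obtain w where "path D u xs w" "path D w (concat ws) v"
    using Plus(5) calculation(1) path_append[OF arcs_db_of] by blast
  moreover have "((u, i), (u, i + 1)) \<in> prel R q"
    using C Plus(3) by (auto simp: prel_iff psucc_def)
  moreover have "((u, i + 1), (w, n + 1 + i)) \<in> (prel R q)\<^sup>*"
    using calculation round by blast
  moreover have "((w, n + 1 + i), (v, n + 1 + i)) \<in> (prel R q)\<^sup>*"
    using calculation rounds by blast
  moreover have "((v, n + 1 + i), (v, cont_at q i)) \<in> prel R q"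
    by (auto simp: prel_iff psucc_def Let_def)
  ultimately show ?case
    by (meson converse_rtrancl_into_rtrancl rtrancl_into_rtrancl rtrancl_trans)
qed

lemma reach_iff:
  assumes "u \<in> set (node_list R)" "v \<in> set (node_list R)"
  shows "((u, 0), (v, n)) \<in> (prel R q)\<^sup>* \<longleftrightarrow> (u, v) \<in> rpq_result q D"
proof
  assume "((u, 0), (v, n)) \<in> (prel R q)\<^sup>*"
  then obtain as where "as \<in> state_lang q 0" "path D u as v"
    using reach_imp_path assms by (force simp: pstates_def)
  moreover have "state_lang q 0 = lang q" by (simp add: state_lang_def sub_at_0)
  ultimately show "(u, v) \<in> rpq_result q D"
    using assms by (auto simp: rpq_result_def db_of_def)
next
  assume "(u, v) \<in> rpq_result q D"
  then obtain as where "as \<in> lang q" "path D u as v" by (auto simp: rpq_result_def)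
  then show "((u, 0), (v, n)) \<in> (prel R q)\<^sup>*"
    using path_imp_reach[of 0 as u v] by (simp add: sub_at_0)
qed

end

section \<open>A program logic with elapsed time\<close>

text \<open>\<open>max_gap\<close> includes the time after the last output, which is not known while
  a trace is still being extended. It is therefore split into a check made at each output,
  \<open>paced\<close>, and a running clock, \<open>elapsed\<close>; both can be computed piecewise
  along an append.\<close>

fun elapsed :: "nat \<Rightarrow> event list \<Rightarrow> nat" where
  "elapsed k [] = k"
| "elapsed k (Tick # es) = elapsed (k + 1) es"
| "elapsed k (Out p # es) = elapsed 0 es"

fun paced :: "nat \<Rightarrow> nat \<Rightarrow> event list \<Rightarrow> bool" where
  "paced B k [] \<longleftrightarrow> True"
| "paced B k (Tick # es) \<longleftrightarrow> paced B (k + 1) es"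
| "paced B k (Out p # es) \<longleftrightarrow> k + 1 \<le> B \<and> paced B 0 es"

lemma elapsed_append: "elapsed k (es @ fs) = elapsed (elapsed k es) fs"
  by (induction k es rule: elapsed.induct) auto

lemma paced_append: "paced B k (es @ fs) \<longleftrightarrow> paced B k es \<and> paced B (elapsed k es) fs"
  by (induction B k es rule: paced.induct) auto

lemma outputs_append: "outputs (es @ fs) = outputs es @ outputs fs"
  by (induction es rule: outputs.induct) auto

lemma max_gap_le: "paced B k es \<Longrightarrow> elapsed k es \<le> B \<Longrightarrow> max_gap k es \<le> B"
  by (induction B k es rule: paced.induct) auto

type_synonym assn = "(nat \<Rightarrow> nat) \<Rightarrow> (nat \<Rightarrow> nat) \<Rightarrow> (nat \<times> nat) list \<Rightarrow> nat \<Rightarrow> bool"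

text \<open>
  Assertions speak about the registers, the work memory, the outputs so far and the time
  elapsed since the last of them. \<open>B\<close> is the delay to be respected.
\<close>

locale ram =
  fixes wl :: nat and inp :: "nat \<Rightarrow> nat" and B :: nat
begin

definition M :: nat where "M = 2 ^ wl"

definition wp :: "com \<Rightarrow> assn \<Rightarrow> assn" where
  "wp c Q r m os k \<longleftrightarrow> (\<exists>tr s'. exec wl inp c \<lparr>reg = r, mem = m\<rparr> tr s' \<and> paced B k tr \<and>
     Q (reg s') (mem s') (os @ outputs tr) (elapsed k tr))"

text \<open>Unlike \<open>wp\<close>, the stronger condition \<open>vc\<close> demands that no result is reduced modulo \<open>M\<close>.\<close>

primrec vc :: "com \<Rightarrow> assn \<Rightarrow> assn" where
  "vc Skip Q = (\<lambda>r m os k. Q r m os (k + 1))"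
| "vc (Const x n) Q = (\<lambda>r m os k. n < M \<and> Q (r(x := n)) m os (k + 1))"
| "vc (Arith f x a b) Q =
     (\<lambda>r m os k. arith f (r a) (r b) < M \<and> Q (r(x := arith f (r a) (r b))) m os (k + 1))"
| "vc (Read x a) Q = (\<lambda>r m os k. inp (r a) < M \<and> Q (r(x := inp (r a))) m os (k + 1))"
| "vc (Load x a) Q = (\<lambda>r m os k. m (r a) < M \<and> Q (r(x := m (r a))) m os (k + 1))"
| "vc (Store a b) Q = (\<lambda>r m os k. Q r (m(r a := r b)) os (k + 1))"
| "vc (Output a b) Q = (\<lambda>r m os k. k + 1 \<le> B \<and> Q r m (os @ [(r a, r b)]) 0)"
| "vc (Seq c d) Q = vc c (vc d Q)"
| "vc (If b c d) Q =
     (\<lambda>r m os k. if r b \<noteq> 0 then vc c Q r m os (k + 1) else vc d Q r m os (k + 1))"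
| "vc (While b c) Q = wp (While b c) Q"

lemma wp_mono: "wp c P r m os k \<Longrightarrow> (\<And>r m os k. P r m os k \<Longrightarrow> Q r m os k) \<Longrightarrow> wp c Q r m os k"
  unfolding wp_def by blast

lemma state_eta [simp]: "\<lparr>reg = reg s, mem = mem s\<rparr> = s"
  by (cases s) simp

lemma wp_Seq: "wp c (wp d Q) r m os k \<Longrightarrow> wp (Seq c d) Q r m os k"
proof -
  assume "wp c (wp d Q) r m os k"
  then obtain tr s tr' s' where "exec wl inp c \<lparr>reg = r, mem = m\<rparr> tr s" "paced B k tr"
    "exec wl inp d s tr' s'" "paced B (elapsed k tr) tr'"
    "Q (reg s') (mem s') ((os @ outputs tr) @ outputs tr') (elapsed (elapsed k tr) tr')"
    unfolding wp_def by auto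
  then show ?thesis unfolding wp_def
    by (intro exI[of _ "tr @ tr'"] exI[of _ s'])
      (auto intro: exec_Seq simp: paced_append elapsed_append outputs_append)
qed

lemma vc_imp_wp: "vc c Q r m os k \<Longrightarrow> wp c Q r m os k"
proof (induction c arbitrary: Q r m os k)
  case Skip
  then show ?case unfolding wp_def by (intro exI conjI) (rule exec_Skip, auto)
next
  case (Const x n)
  then show ?case unfolding wp_def
    by (intro exI conjI) (rule exec_Const, auto simp: set_reg_def M_def)
next
  case (Arith f x a b)
  then show ?case unfolding wp_def
    by (intro exI conjI) (rule exec_Arith, auto simp: set_reg_def M_def)
next
  case (Read x a)
  then show ?case unfolding wp_def
    by (intro exI conjI) (rule exec_Read, auto simp: set_reg_def M_def)
next
  case (Load x a)
  then show ?case unfolding wp_def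
    by (intro exI conjI) (rule exec_Load, auto simp: set_reg_def M_def)
next
  case (Store a b)
  then show ?case unfolding wp_def by (intro exI conjI) (rule exec_Store, auto)
next
  case (Output a b)
  then show ?case unfolding wp_def by (intro exI conjI) (rule exec_Output, auto)
next
  case (Seq c d)
  then have "wp c (vc d Q) r m os k" by simp
  then have "wp c (wp d Q) r m os k" using Seq.IH(2) wp_mono by blast
  then show ?case by (rule wp_Seq)
next
  case (If b c d)
  show ?case
  proof (cases "r b = 0")
    case True
    then have "wp d Q r m os (k + 1)" using If by simp
    then obtain tr s' where "exec wl inp d \<lparr>reg = r, mem = m\<rparr> tr s'" "paced B (k + 1) tr"
      "Q (reg s') (mem s') (os @ outputs tr) (elapsed (k + 1) tr)"
      unfolding wp_def by blast
    then show ?thesis unfolding wp_def using True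
      by (intro exI[of _ "Tick # tr"] exI[of _ s']) (auto intro: exec_If_False)
  next
    case False
    then have "wp c Q r m os (k + 1)" using If by simp
    then obtain tr s' where "exec wl inp c \<lparr>reg = r, mem = m\<rparr> tr s'" "paced B (k + 1) tr"
      "Q (reg s') (mem s') (os @ outputs tr) (elapsed (k + 1) tr)"
      unfolding wp_def by blast
    then show ?thesis unfolding wp_def using False
      by (intro exI[of _ "Tick # tr"] exI[of _ s']) (auto intro: exec_If_True)
  qed
next
  case (While b c)
  then show ?case by simp
qed

lemma wp_While_False: "r b = 0 \<Longrightarrow> Q r m os (k + 1) \<Longrightarrow> wp (While b c) Q r m os k"
  unfolding wp_def by (intro exI conjI) (rule exec_While_False, auto)

lemma wp_While_True:
  assumes "r b \<noteq> 0" "wp c (wp (While b c) Q) r m os (k + 1)"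
  shows "wp (While b c) Q r m os k"
proof -
  from assms(2) obtain tr s tr' s' where "exec wl inp c \<lparr>reg = r, mem = m\<rparr> tr s" "paced B (k + 1) tr"
    "exec wl inp (While b c) s tr' s'" "paced B (elapsed (k + 1) tr) tr'"
    "Q (reg s') (mem s') ((os @ outputs tr) @ outputs tr') (elapsed (elapsed (k + 1) tr) tr')"
    unfolding wp_def by auto
  then show ?thesis unfolding wp_def using assms(1)
    by (intro exI[of _ "Tick # tr @ tr'"] exI[of _ s'])
      (auto intro!: exec_While_True simp: paced_append elapsed_append outputs_append)
qed

text \<open>The variant \<open>x\<close> serves termination only. The time is not tied to it but
  lives in the invariant through \<open>k\<close>, which allows amortised bounds; the final
  \<open>k + 1\<close> is the failing test.\<close>

lemma vc_While:
  fixes x :: nat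
  assumes "I x r m os k"
    and "\<And>x r m os k. I x r m os k \<Longrightarrow> r b \<noteq> 0 \<Longrightarrow>
      vc c (\<lambda>r m os k. \<exists>y < x. I y r m os k) r m os (k + 1)"
    and "\<And>x r m os k. I x r m os k \<Longrightarrow> r b = 0 \<Longrightarrow> Q r m os (k + 1)"
  shows "vc (While b c) Q r m os k"
proof -
  have "wp (While b c) Q r m os k" if "I x r m os k" for x r m os k
    using that
  proof (induction x arbitrary: r m os k rule: less_induct)
    case (less x)
    show ?case
    proof (cases "r b = 0")
      case True
      then show ?thesis using less.prems assms(3) by (intro wp_While_False) auto
    next
      case False
      have "wp c (\<lambda>r m os k. \<exists>y < x. I y r m os k) r m os (k + 1)"
        using assms(2) less.prems False by (intro vc_imp_wp) auto
      then have "wp c (wp (While b c) Q) r m os (k + 1)"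
        by (rule wp_mono) (use less.IH in auto)
      with False show ?thesis by (rule wp_While_True)
    qed
  qed
  then show ?thesis using assms(1) by auto
qed

end

fun block :: "com list \<Rightarrow> com" where
  "block [] = Skip"
| "block [c] = c"
| "block (c # d # cs) = Seq c (block (d # cs))"

text \<open>
  Four arrays are interleaved in the work memory: the end (\<open>0\<close>) and the continuation (\<open>1\<close>) of
  every position, the marks (\<open>2\<close>) and the stack (\<open>3\<close>) of the search. Registers \<open>0\<close> to \<open>4\<close> hold
  their own numbers, so that register \<open>j\<close> is also the offset of array \<open>j\<close>, and register \<open>24\<close> is
  the address register. Register \<open>11\<close> points into the list of nodes, \<open>12\<close> is the node whose
  answers are sought, \<open>13\<close> is nonzero if the marks have to be cleared, \<open>14\<close> is the height of the
  stack, \<open>19\<close> points into the list being traversed, and \<open>20\<close> and \<open>21\<close> are the node and the state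
  to be pushed.
\<close>

definition addr :: "nat \<Rightarrow> nat \<Rightarrow> nat" where
  "addr j i = 4 * i + j"

lemma addr_eq_iff [simp]: "j < 4 \<Longrightarrow> j' < 4 \<Longrightarrow> addr j i = addr j' i' \<longleftrightarrow> j = j' \<and> i = i'"
  unfolding addr_def by presburger

definition get :: "nat \<Rightarrow> nat \<Rightarrow> nat \<Rightarrow> com" where
  "get j x i = block [Arith Mul 24 i 4, Arith Add 24 24 j, Load x 24]"

definition put :: "nat \<Rightarrow> nat \<Rightarrow> nat \<Rightarrow> com" where
  "put j i x = block [Arith Mul 24 i 4, Arith Add 24 24 j, Store 24 x]"

context ram
begin

lemma vc_get:
  assumes "r 4 = 4" "r j = j" "j < 4" "addr 3 (r i) < M" "m (addr j (r i)) < M"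
    and "Q (r(24 := addr j (r i), x := m (addr j (r i)))) m os (k + 3)"
  shows "vc (get j x i) Q r m os k"
  using assms by (auto simp: get_def addr_def eval_nat_numeral algebra_simps)

lemma vc_put:
  assumes "r 4 = 4" "r j = j" "j < 4" "addr 3 (r i) < M" "x \<noteq> 24"
    and "Q (r(24 := addr j (r i))) (m(addr j (r i) := r x)) os (k + 3)"
  shows "vc (put j i x) Q r m os k"
  using assms by (auto simp: put_def addr_def eval_nat_numeral algebra_simps)

end

section \<open>Expanding a product state\<close>

lemma list_at_0: "list_at inp 0 xs \<longleftrightarrow> xs = []"
  by (auto intro: list_at_Nil elim: list_at.cases)

lemma list_at_nonzero:
  "p \<noteq> 0 \<Longrightarrow> list_at inp p xs \<longleftrightarrow> (\<exists>ys. xs = inp p # ys \<and> list_at inp (inp (p + 1)) ys)"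
  by (auto intro: list_at_Cons elim: list_at.cases)

lemma list_at_elem: "list_at inp p xs \<Longrightarrow> x \<in> set xs \<Longrightarrow> \<exists>a. x = inp a"
  by (induction rule: list_at.induct) auto

definition agree :: "nat set \<Rightarrow> (nat \<Rightarrow> nat) \<Rightarrow> (nat \<Rightarrow> nat) \<Rightarrow> bool" where
  "agree X r r' \<longleftrightarrow> (\<forall>i. i \<notin> X \<longrightarrow> r' i = r i)"

lemma agree_refl [intro!]: "agree X r r"
  by (simp add: agree_def)

lemma agree_upd [intro!]: "i \<in> X \<Longrightarrow> agree X r r' \<Longrightarrow> agree X r (r'(i := a))"
  by (simp add: agree_def)

lemma agree_trans: "agree X r r' \<Longrightarrow> agree X r' r'' \<Longrightarrow> agree X r r''"
  by (simp add: agree_def)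

lemma agreeD: "agree X r r' \<Longrightarrow> i \<notin> X \<Longrightarrow> r' i = r i"
  by (simp add: agree_def)

definition push :: com where
  "push = block [Arith Mul 22 20 9, Arith Add 22 22 21, get 2 25 22,
     If 25 Skip (block [put 2 22 1, put 3 14 22, Arith Add 14 14 1])]"

definition push_arc :: com where
  "push_arc = block [Read 20 19, push, Arith Add 25 19 1, Read 19 25]"

text \<open>Register \<open>25\<close> holds the symbol minus \<open>3\<close>, which is
  \<open>x + 1\<close> for the letter \<open>x\<close>. Adding it and subtracting \<open>1\<close>
  yields the entry for that letter in the array of successor lists.\<close>

definition push_arcs :: com where
  "push_arcs = block [Arith Mul 19 8 16, Arith Add 19 19 7, Arith Add 19 19 25, Arith Sub 19 19 1,
     Read 19 19, Arith Add 21 27 0, While 19 push_arc]"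

definition push_right :: com where
  "push_right = block [Arith Add 25 17 1, get 0 21 25, push]"

text \<open>The symbols \<open>1\<close>, \<open>2\<close>, \<open>3\<close> all have an edge to the
  next position. Testing the symbol minus \<open>1\<close> and minus \<open>2\<close> singles out
  \<open>2\<close>, that is \<open>Alt\<close>, whose second operand starts where the first one
  ends.\<close>

definition push_subs :: com where
  "push_subs = block [Arith Add 21 17 1, push, Arith Sub 25 18 1,
     If 25 (block [Arith Sub 25 18 2, If 25 Skip push_right]) Skip]"

definition push_cont :: com where
  "push_cont = block [Arith Add 21 27 0, push]"

text \<open>The symbol minus \<open>3\<close> is nonzero exactly for letters; among the others,
  symbol \<open>0\<close> is \<open>Eps\<close>.\<close>

definition push_succs :: com where
  "push_succs = If 25 push_arcs (If 18 push_subs push_cont)"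

definition expand_node :: com where
  "expand_node = block [Arith Add 25 6 17, Read 18 25, get 1 27 17, Arith Add 20 16 0,
     Arith Sub 25 18 3, push_succs]"

definition expand_loop :: com where
  "expand_loop = block [Arith Sub 26 26 1, Arith Add 21 26 1, Arith Add 20 16 0, push,
     get 1 21 26, push]"

text \<open>By truncated subtraction, \<open>n - s\<close> is nonzero below the final state and
  \<open>s - n\<close> above it; in the latter case register \<open>26\<close> holds
  \<open>i + 1\<close> for the state \<open>n + 1 + i\<close>. What remains is the final state,
  which raises the flag in register \<open>13\<close>.\<close>

definition expand :: com where
  "expand = block [Arith Sub 14 14 1, get 3 15 14, Arith Div 16 15 9, Arith Mul 17 16 9,
     Arith Sub 17 15 17, Arith Sub 26 5 17,
     If 26 expand_node
       (block [Arith Sub 26 17 5, If 26 expand_loop (Arith Add 13 1 0)])]"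

section \<open>Word length and the memory invariant of a search\<close>

locale enum_run = product sigma R q + ram wl inp B
  for sigma R q wl inp B +
  fixes w :: nat
  assumes stores: "stores sigma w inp R q"
    and wl: "wl = (sigma + 9) * w"
begin

definition W :: nat where "W = 2 ^ w"

abbreviation "V \<equiv> set (node_list R)"
abbreviation "P \<equiv> pstates R q"

lemma inp_less_W: "inp p < W"
  using stores by (simp add: stores_def W_def)

lemma n_less_W: "n < W"
  using stores inp_less_W[of 3] by (simp add: stores_def)

lemma W_ge_2: "2 \<le> W"
  using n_less_W rpq_length_pos[of q] by linarith

text \<open>The dominating numbers are addresses: codes of product states are below
  \<open>2 * W * W\<close> and are multiplied by \<open>4\<close> for the interleaving, and the
  array of successor lists is indexed up to about \<open>sigma * W\<close>. Since \<open>W\<close>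
  is at least \<open>2\<close>, the factor \<open>sigma + 1\<close> fits into
  \<open>W ^ sigma\<close> and the factor \<open>128\<close> into \<open>W ^ 7\<close>. With
  \<open>W * W\<close> this makes \<open>W ^ (sigma + 9)\<close>, hence the word length
  \<open>(sigma + 9) * w\<close>.\<close>

lemma M_bound: "16 * (W * W) + (sigma + 4) * W + 16 < M"
proof -
  have "sigma + 1 \<le> 2 ^ sigma" by (metis Suc_eq_plus1 Suc_leI less_exp)
  also have "\<dots> \<le> W ^ sigma" using W_ge_2 by (rule power_mono) simp
  finally have 1: "sigma + 1 \<le> W ^ sigma" .
  have "2 ^ 7 * (W * W) \<le> W ^ 7 * (W * W)" using power_mono[OF W_ge_2, of 7] by simp
  also have "\<dots> = W ^ 9" by (simp add: eval_nat_numeral)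
  finally have 2: "128 * (W * W) \<le> W ^ 9" by simp
  have "(sigma + 1) * (128 * (W * W)) \<le> W ^ sigma * W ^ 9" by (rule mult_le_mono[OF 1 2])
  also have "\<dots> = M"
    unfolding M_def W_def
    by (simp add: wl power_add[symmetric] power_mult[symmetric] algebra_simps)
  finally have 3: "128 * (W * W) + 128 * (sigma * (W * W)) \<le> M" by (simp add: algebra_simps)
  have "2 * W \<le> W * W" using W_ge_2 by simp
  moreover from this have "sigma * W \<le> sigma * (W * W)" using W_ge_2 by simp
  moreover have "(sigma + 4) * W = sigma * W + 4 * W" by (simp add: algebra_simps)
  ultimately show ?thesis using 3 W_ge_2 by linarith
qed

lemma inp_less_M [simp]: "inp p < M"
  using inp_less_W[of p] M_bound by (simp add: algebra_simps)

lemma small_less_M: "x \<le> 4 * W \<Longrightarrow> x < M"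
  using M_bound by (simp add: algebra_simps)

lemma list_at_nodes: "list_at inp (inp 1) (node_list R)"
  using stores by (simp add: stores_def)

lemma node_less_W: "u \<in> V \<Longrightarrow> u < W"
  using list_at_elem[OF list_at_nodes] inp_less_W by metis

lemma list_at_succ:
  "u \<in> V \<Longrightarrow> x < sigma \<Longrightarrow> list_at inp (inp (inp 4 + sigma * u + x)) (succ_list R u x)"
  using stores by (simp add: stores_def)

lemma read_symbol: "i < n \<Longrightarrow> inp (inp 2 + i) = sym (sub_at q i)"
  using stores symbols_nth[of i q] by (simp add: stores_def)

definition width :: nat where "width = 2 * n + 2"

definition code :: "nat \<times> nat \<Rightarrow> nat" where
  "code x = fst x * width + snd x"

lemma code_div_mod:
  assumes "x \<in> P"
  shows "code x div width = fst x" "code x - fst x * width = snd x"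
proof -
  have "snd x < width" using assms by (auto simp: pstates_def width_def)
  then show "code x div width = fst x" "code x - fst x * width = snd x"
    by (simp_all add: code_def)
qed

lemma code_inj: "x \<in> P \<Longrightarrow> y \<in> P \<Longrightarrow> code x = code y \<longleftrightarrow> x = y"
  by (metis code_div_mod prod_eqI)

lemma code_less: "x \<in> P \<Longrightarrow> addr 3 (code x) < M"
proof -
  assume x: "x \<in> P"
  then have "fst x + 1 \<le> W" "snd x < width" using node_less_W
    by (auto simp: pstates_def width_def Suc_le_eq)
  then have "code x < (fst x + 1) * width" by (simp add: code_def)
  also have "\<dots> \<le> W * (2 * W)" using \<open>fst x + 1 \<le> W\<close> n_less_W by (intro mult_mono) (auto simp: width_def)
  finally show ?thesis using M_bound by (simp add: addr_def algebra_simps)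
qed

lemma finite_P [simp]: "finite P"
  by (simp add: pstates_def)

lemma card_P_le: "card P \<le> W * (2 * W)"
proof -
  have "V \<subseteq> {..<W}" using node_less_W by auto
  then have "card V \<le> W" using card_mono[of "{..<W}" V] by simp
  then have "card V * card {..2 * n} \<le> W * (2 * W)" using n_less_W
    by (intro mult_mono) auto
  then show ?thesis by (simp add: pstates_def card_cartesian_product)
qed

lemma card_P_less: "i \<le> card P \<Longrightarrow> addr 3 i < M"
  using card_P_le M_bound by (simp add: addr_def)

definition const_regs :: "(nat \<Rightarrow> nat) \<Rightarrow> bool" where
  "const_regs r \<longleftrightarrow> r 0 = 0 \<and> r 1 = 1 \<and> r 2 = 2 \<and> r 3 = 3 \<and> r 4 = 4 \<and> r 5 = n \<and> r 6 = inp 2 \<and>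
     r 7 = inp 4 \<and> r 8 = sigma \<and> r 9 = width"

definition tables :: "(nat \<Rightarrow> nat) \<Rightarrow> bool" where
  "tables m \<longleftrightarrow> (\<forall>i < n. m (addr 0 i) = end_at q i \<and> m (addr 1 i) = cont_at q i)"

definition marks :: "(nat \<Rightarrow> nat) \<Rightarrow> (nat \<times> nat) set \<Rightarrow> bool" where
  "marks m Vis \<longleftrightarrow> (\<forall>x \<in> P. m (addr 2 (code x)) = (if x \<in> Vis then 1 else 0))"

definition stack :: "(nat \<Rightarrow> nat) \<Rightarrow> (nat \<times> nat) list \<Rightarrow> bool" where
  "stack m ws \<longleftrightarrow> (\<forall>i < length ws. m (addr 3 i) = code (ws ! i))"

text \<open>The states in \<open>Vis\<close> that are not on the stack are those already expanded.
  Distinctness and \<open>Vis \<subseteq> P\<close> bound the height of the stack by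
  \<open>card P\<close>, which keeps its addresses within a word.\<close>

definition search :: "(nat \<Rightarrow> nat) \<Rightarrow> (nat \<Rightarrow> nat) \<Rightarrow> (nat \<times> nat) set \<Rightarrow> (nat \<times> nat) list \<Rightarrow> bool"
  where
  "search r m Vis ws \<longleftrightarrow> const_regs r \<and> tables m \<and> marks m Vis \<and> stack m ws \<and> r 14 = length ws \<and>
     distinct ws \<and> set ws \<subseteq> Vis \<and> Vis \<subseteq> P"

lemma const_regsD:
  assumes "const_regs r"
  shows "r 0 = 0" "r 1 = 1" "r (Suc 0) = 1" "r 2 = 2" "r 3 = 3" "r 4 = 4" "r 5 = n" "r 6 = inp 2"
    "r 7 = inp 4" "r 8 = sigma" "r 9 = width"
  using assms by (simp_all add: const_regs_def)

lemma const_regs_agree: "const_regs r \<Longrightarrow> agree X r r' \<Longrightarrow> X \<inter> {..9} = {} \<Longrightarrow> const_regs r'"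
proof -
  assume "const_regs r" "agree X r r'" "X \<inter> {..9} = {}"
  then have "r' i = r i" if "i \<le> 9" for i using that unfolding agree_def by blast
  then show ?thesis using \<open>const_regs r\<close> by (simp add: const_regs_def)
qed

lemma const_regs_upd [simp]: "9 < i \<Longrightarrow> const_regs (r(i := a)) \<longleftrightarrow> const_regs r"
  by (simp add: const_regs_def)

text \<open>A state is marked when it is pushed, not when it is expanded, so none enters the stack
  twice in a search.\<close>

lemma vc_push:
  assumes s: "search r m Vis ws" and y: "y \<in> P" "r 20 = fst y" "r 21 = snd y"
    and Q: "\<And>r' m' ws' k'. search r' m' (insert y Vis) ws' \<Longrightarrow> set ws' = set ws \<union> ({y} - Vis) \<Longrightarrow>
      agree {14, 22, 24, 25} r r' \<Longrightarrow> k' \<le> k + 13 \<Longrightarrow> Q r' m' os k'"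
  shows "vc push Q r m os k"
proof -
  have c: "const_regs r" using s by (simp add: search_def)
  note c' = const_regsD[OF c]
  have r: "fst y * width + snd y = code y" by (simp add: code_def)
  have less: "code y < M" using code_less[OF y(1)] by (simp add: addr_def)
  then have less': "fst y * width < M" by (simp add: code_def)
  have mark: "m (addr 2 (code y)) = (if y \<in> Vis then 1 else 0)"
    using s y(1) by (simp add: search_def marks_def)
  have "1 < M" using small_less_M W_ge_2 by simp
  note [simp] = c' y(2,3) less less' r code_less[OF y(1)] \<open>1 < M\<close>[simplified]
  show ?thesis
  proof (cases "y \<in> Vis")
    case True
    have 1: "search r' m (insert y Vis) ws" if "const_regs r'" "r' 14 = r 14" for r'
      using s True that by (auto simp: search_def insert_absorb)
    show ?thesis
      using c mark True unfolding push_def block.simps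
      by (auto intro!: vc_get Q[of _ _ ws] 1)
  next
    case False
    \<comment> \<open>The inclusion is proper because \<open>y\<close> is unmarked; this leaves room
      for one more entry.\<close>
    have sub: "set ws \<subset> P" using s False y(1) by (auto simp: search_def)
    then have len: "length ws < card P"
      using s psubset_card_mono[OF finite_P sub] by (simp add: search_def distinct_card)
    have ad: "addr 3 (length ws) < M" "Suc (length ws) < M"
      using len card_P_less[of "length ws"] card_P_less[of "card P"] by (auto simp: addr_def)
    have len14: "r 14 = length ws" using s by (simp add: search_def)
    let ?m = "m(addr 2 (code y) := 1, addr 3 (length ws) := code y)"
    have 1: "search r' ?m (insert y Vis) (ws @ [y])"
      if "const_regs r'" "r' 14 = length ws + 1" for r'
      using s False y(1) code_inj[OF _ y(1)] that
      by (auto simp: search_def tables_def marks_def stack_def nth_append less_Suc_eq)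
    show ?thesis
      using c mark False ad unfolding push_def block.simps
      by (auto simp: len14 intro!: vc_get vc_put Q[of _ _ "ws @ [y]"] 1[simplified])
  qed
qed

text \<open>Induction on the remaining list, along which \<open>list_at\<close> unfolds. An arc
  costs \<open>17\<close>: the loop test, reading the element, \<open>13\<close> for
  \<open>push\<close>, and \<open>2\<close> to follow the pointer.\<close>

lemma vc_push_arcs_loop:
  assumes "search r m Vis ws" "list_at inp (r 19) vs" "set vs \<subseteq> V" "r 19 < W" "r 21 = t" "t \<le> 2 * n"
    and "\<And>r' m' ws' k'. search r' m' ((\<lambda>v. (v, t)) ` set vs \<union> Vis) ws' \<Longrightarrow>
      set ws' = set ws \<union> ((\<lambda>v. (v, t)) ` set vs - Vis) \<Longrightarrow>
      agree {14, 19, 20, 22, 24, 25} r r' \<Longrightarrow> k' \<le> k + 1 + 17 * length vs \<Longrightarrow> Q r' m' os k'"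
  shows "vc (While 19 push_arc) Q r m os k"
  using assms
proof (induction vs arbitrary: r m Vis ws k)
  case Nil
  then have "r 19 = 0" using list_at_nonzero by fastforce
  then show ?case using Nil.prems by (auto intro!: wp_While_False Nil.prems(7))
next
  case (Cons v vs)
  have r19: "r 19 \<noteq> 0" using Cons.prems(2) list_at_0 by (metis list.distinct(1))
  then have v: "inp (r 19) = v" "list_at inp (inp (r 19 + 1)) vs"
    using Cons.prems(2) list_at_nonzero by auto
  have vt: "(v, t) \<in> P" using Cons.prems(3,6) by (simp add: pstates_def)
  have c: "const_regs r" using Cons.prems(1) by (simp add: search_def)
  have r19M: "Suc (r 19) < M" using Cons.prems(4) W_ge_2 small_less_M by simp
  define X where "X = wp (While 19 push_arc) Q"
  have "vc push_arc X r m os (k + 1)"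
    unfolding push_arc_def block.simps vc.simps
    apply (intro conjI)
    apply simp
    apply (rule vc_push[where y = "(v, t)" and Vis = Vis and ws = ws])
    subgoal using Cons.prems(1) by (simp add: search_def)
    subgoal by (rule vt)
    subgoal by (simp add: v)
    subgoal using Cons.prems(5) by simp
    subgoal premises p for r' m' ws' k'
    proof -
      have c': "const_regs r'" using p(1) by (simp add: search_def)
      have r': "r' 19 = r 19" "r' 21 = r 21" using p(3) by (simp_all add: agree_def)
      let ?r = "r'(25 := Suc (r 19), 19 := inp (Suc (r 19)))"
      have "vc (While 19 push_arc) Q ?r m' os (k' + 2)"
      proof (rule Cons.IH[where Vis = "insert (v, t) Vis" and ws = ws'])
        show "search ?r m' (insert (v, t) Vis) ws'"
          using p(1) by (auto simp: search_def)
        show "list_at inp (?r 19) vs" using v by simp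
        show "set vs \<subseteq> V" "?r 19 < W" "?r 21 = t" "t \<le> 2 * n"
          using Cons.prems r' inp_less_W by auto
        fix r'' m'' ws'' k''
        assume a: "search r'' m'' ((\<lambda>v. (v, t)) ` set vs \<union> insert (v, t) Vis) ws''"
          "set ws'' = set ws' \<union> ((\<lambda>v. (v, t)) ` set vs - insert (v, t) Vis)"
          "agree {14, 19, 20, 22, 24, 25} ?r r''" "k'' \<le> k' + 2 + 1 + 17 * length vs"
        show "Q r'' m'' os k''"
        proof (rule Cons.prems(7))
          show "search r'' m'' ((\<lambda>v. (v, t)) ` set (v # vs) \<union> Vis) ws''" using a(1) by simp
          show "set ws'' = set ws \<union> ((\<lambda>v. (v, t)) ` set (v # vs) - Vis)" using a(2) p(2) by auto
          show "agree {14, 19, 20, 22, 24, 25} r r''" using a(3) p(3) by (auto simp: agree_def)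
          show "k'' \<le> k + 1 + 17 * length (v # vs)" using a(4) p(4) by simp
        qed
      qed
      then show ?thesis using const_regsD[OF c'] r' r19M by (simp add: X_def)
    qed
    done
  then show ?case using r19 by (simp add: wp_While_True vc_imp_wp X_def)
qed

lemma search_upd [simp]:
  "9 < i \<Longrightarrow> i \<noteq> 14 \<Longrightarrow> search (r(i := a)) m Vis ws \<longleftrightarrow> search r m Vis ws"
  by (simp add: search_def)

lemma search_const_regs: "search r m Vis ws \<Longrightarrow> const_regs r"
  by (simp add: search_def)

lemma state_less_M:
  assumes "i < n" "j \<le> 2 * n"
  shows "i < M" "Suc i < M" "addr 3 i < M" "Suc i < n \<Longrightarrow> addr 3 (Suc i) < M" "j < M"
    "sym (sub_at q i) < M" "sym (sub_at q i) - l < M" "inp 2 + i < M"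
proof -
  have "sym (sub_at q i) < W" using read_symbol[OF assms(1)] inp_less_W by metis
  then show "i < M" "Suc i < M" "addr 3 i < M" "Suc i < n \<Longrightarrow> addr 3 (Suc i) < M" "j < M"
    "sym (sub_at q i) < M" "sym (sub_at q i) - l < M" "inp 2 + i < M"
    using n_less_W inp_less_W[of 2] assms by (auto intro!: small_less_M simp: addr_def)
qed

text \<open>\<open>Conc\<close>, \<open>Alt\<close> and \<open>Plus\<close> are treated at once: the
  assumptions \<open>qs\<close> express the successors through the symbol, which is all that the
  code sees.\<close>

lemma vc_push_subs:
  assumes s: "search r m Vis ws" and x: "v \<in> V" "s < n" "Suc s < n"
    and r: "r 17 = s" "r 18 = sym (sub_at q s)" "r 20 = v"
    and qs: "psucc R q (v, s) =
      (v, s + 1) # (if sym (sub_at q s) = 2 then [(v, end_at q (s + 1))] else [])"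
      "sym (sub_at q s) \<in> {1, 2, 3}" "sym (sub_at q s) = 2 \<Longrightarrow> end_at q (s + 1) < n"
    and Q: "\<And>r' m' ws' k'. search r' m' (set (psucc R q (v, s)) \<union> Vis) ws' \<Longrightarrow>
      set ws' = set ws \<union> (set (psucc R q (v, s)) - Vis) \<Longrightarrow>
      agree ({14..27} - {23}) r r' \<Longrightarrow> k' \<le> k + 40 \<Longrightarrow> Q r' m' os k'"
  shows "vc push_subs Q r m os k"
proof -
  note [simp] = const_regsD[OF search_const_regs[OF s]] r state_less_M[OF x(2), of 0] x
  have Ss: "Suc s \<le> 2 * n" using x(3) by linarith
  define X where "X = vc (block [Arith Sub 25 18 1,
     If 25 (block [Arith Sub 25 18 2, If 25 Skip push_right]) Skip]) Q"
  have X: "X r1 m1 os k1" if a: "search r1 m1 (insert (v, s + 1) Vis) ws1"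
    "set ws1 = set ws \<union> ({(v, s + 1)} - Vis)" "agree {14, 21, 22, 24, 25} r r1" "k1 \<le> k + 14"
    for r1 m1 ws1 k1
  proof -
    have r1: "r1 17 = s" "r1 18 = sym (sub_at q s)" "r1 20 = v"
      using a(3) r by (auto simp: agree_def)
    note [simp] = const_regsD[OF search_const_regs[OF a(1)]] r1
    have e: "m1 (addr 0 (Suc s)) = end_at q (Suc s)"
      using a(1) by (simp add: search_def tables_def)
    show ?thesis
    proof (cases "sym (sub_at q s) = 2")
      case True
      let ?y = "(v, end_at q (s + 1))"
      have yM: "end_at q (Suc s) < M" using state_less_M(1)[of _ 0] qs(3) True by simp
      have "1 < M" using small_less_M W_ge_2 by simp
      have "vc push Q r' m1 os k'"
        if b: "search r' m1 (insert (v, s + 1) Vis) ws1" "r' 20 = v" "r' 21 = end_at q (s + 1)"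
          "agree {14, 21, 22, 24, 25} r r'" "k' \<le> k + 26" for r' k'
      proof (rule vc_push[OF b(1), of ?y])
        show "?y \<in> P" using x(1) qs(3) True by (simp add: pstates_def)
        show "r' 20 = fst ?y" "r' 21 = snd ?y" using b by auto
        fix r'' m'' ws'' k''
        assume c: "search r'' m'' (insert ?y (insert (v, s + 1) Vis)) ws''"
          "set ws'' = set ws1 \<union> ({?y} - insert (v, s + 1) Vis)"
          "agree {14, 22, 24, 25} r' r''" "k'' \<le> k' + 13"
        show "Q r'' m'' os k''"
        proof (rule Q)
          show "search r'' m'' (set (psucc R q (v, s)) \<union> Vis) ws''"
            using c(1) qs(1) True by (simp add: insert_commute)
          show "set ws'' = set ws \<union> (set (psucc R q (v, s)) - Vis)"
            using c(2) a(2) qs(1) True by auto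
          show "agree ({14..27} - {23}) r r''" using c(3) b(4) by (auto simp: agree_def)
          show "k'' \<le> k + 40" using c(4) b(5) by simp
        qed
      qed
      then show ?thesis using True a e yM \<open>1 < M\<close>
        by (auto simp: X_def push_right_def agree_def intro!: vc_get)
    next
      case False
      have "Q (r1(25 := b)) m1 os k'" if "k' \<le> k + 20" for b k'
      proof (rule Q)
        show "search (r1(25 := b)) m1 (set (psucc R q (v, s)) \<union> Vis) ws1"
          using a(1) qs(1) False by simp
        show "set ws1 = set ws \<union> (set (psucc R q (v, s)) - Vis)"
          using a(2) qs(1) False by auto
        show "agree ({14..27} - {23}) r (r1(25 := b))" using a(3) by (auto simp: agree_def)
        show "k' \<le> k + 40" using that by simp
      qed
      moreover have "0 < M" "1 < M" "2 < M" using small_less_M W_ge_2 by simp_all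
      ultimately show ?thesis using False qs(2) a
        by (auto simp: X_def)
    qed
  qed
  have "vc push X r' m os k'" if "search r' m Vis ws" "r' 20 = v" "r' 21 = s + 1"
    "agree {14, 21, 22, 24, 25} r r'" "k' = k + 1" for r' k'
    by (rule vc_push[OF that(1), of "(v, s + 1)"])
      (use that X Ss in \<open>auto simp: pstates_def agree_def\<close>)
  then show ?thesis unfolding push_subs_def block.simps using s
    by (simp add: X_def agree_def)
qed

lemma vc_push_succs:
  assumes s: "search r m Vis ws" and x: "v \<in> V" "s < n"
    and r: "r 16 = v" "r 17 = s" "r 18 = sym (sub_at q s)" "r 20 = v"
      "r 25 = sym (sub_at q s) - 3" "r 27 = cont_at q s"
    and Q: "\<And>r' m' ws' k'. search r' m' (set (psucc R q (v, s)) \<union> Vis) ws' \<Longrightarrow>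
      set ws' = set ws \<union> (set (psucc R q (v, s)) - Vis) \<Longrightarrow>
      agree ({14..27} - {23}) r r' \<Longrightarrow>
      k' \<le> k + 43 + 17 * length (psucc R q (v, s)) \<Longrightarrow> Q r' m' os k'"
  shows "vc push_succs Q r m os k"
proof -
  note [simp] = const_regsD[OF search_const_regs[OF s]] r state_less_M[OF x(2) cont_at_le[OF x(2)]] x
  have subs: "vc push_subs Q r m os (k + 2)" if "Suc s < n"
    "psucc R q (v, s) = (v, s + 1) # (if sym (sub_at q s) = 2 then [(v, end_at q (s + 1))] else [])"
    "sym (sub_at q s) \<in> {1, 2, 3}" "sym (sub_at q s) = 2 \<Longrightarrow> end_at q (s + 1) < n"
  proof (rule vc_push_subs[OF s x(1,2) that(1) r(2-4) that(2-4)])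
    fix r' m' ws' k'
    assume a: "search r' m' (set (psucc R q (v, s)) \<union> Vis) ws'"
      "set ws' = set ws \<union> (set (psucc R q (v, s)) - Vis)"
      "agree ({14..27} - {23}) r r'" "k' \<le> k + 2 + 40"
    show "Q r' m' os k'" by (rule Q[OF a(1-3)]) (use a(4) in linarith)
  qed
  show ?thesis
  proof (cases "sub_at q s")
    case Eps
    have "vc push Q r' m os k'" if "search r' m Vis ws" "r' 20 = v" "r' 21 = cont_at q s"
      "agree {14, 21, 22, 24, 25} r r'" "k' \<le> k + 3" for r' k'
      by (rule vc_push[OF that(1), of "(v, cont_at q s)"])
        (use that Eps cont_at_le[OF x(2)] in \<open>auto simp: pstates_def agree_def psucc_def intro!: Q\<close>)
    then show ?thesis using Eps s
      by (auto simp: push_succs_def push_cont_def agree_def)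
  next
    case (Letter y)
    have y: "y < sigma" using letter_less[OF x(2) Letter] .
    have sy: "y + 4 < W" using read_symbol[OF x(2)] inp_less_W[of "inp 2 + s"] Letter by simp
    have less: "v < W" "inp 4 < W" using node_less_W[OF x(1)] inp_less_W by auto
    then have "sigma * v \<le> sigma * W" by (intro mult_le_mono2) simp
    then have MM: "sigma * v + inp 4 + (y + 4) < M" using less sy
      using M_bound unfolding add_mult_distrib by linarith
    have ps: "psucc R q (v, s) = map (\<lambda>u. (u, cont_at q s)) (succ_list R v y)"
      using Letter by (simp add: psucc_def)
    have loop: "vc (While 19 push_arc) Q r' m os k'" if a: "search r' m Vis ws"
      "r' 19 = inp (inp 4 + sigma * v + y)" "r' 21 = cont_at q s"
      "agree {14, 19, 20, 21, 22, 24, 25} r r'" "k' \<le> k + 7" for r' k'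
    proof (rule vc_push_arcs_loop[OF a(1)])
      show "list_at inp (r' 19) (succ_list R v y)" using a(2) list_at_succ[OF x(1) y] by simp
      show "set (succ_list R v y) \<subseteq> V" using valid x(1) y by (auto simp: valid_rep_def)
      show "r' 19 < W" using a inp_less_W by simp
      show "r' 21 = cont_at q s" using a by simp
      show "cont_at q s \<le> 2 * n" by (rule cont_at_le[OF x(2)])
    qed (rule Q, use a ps in \<open>auto simp: agree_def\<close>)
    have "vc push_arcs Q r m os (k + 1)"
      unfolding push_arcs_def block.simps vc.simps(1-6) vc.simps(8-9)
      apply (use Letter MM s in simp)
      apply (rule loop[unfolded vc.simps])
      apply (simp_all add: agree_def add_ac)
      done
    then show ?thesis using Letter by (simp add: push_succs_def)
  next
    case (Conc a b)
    have "vc push_subs Q r m os (k + 2)"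
      by (rule subs) (use Conc Conc_less[OF x(2) Conc] in \<open>simp_all add: psucc_def\<close>)
    then show ?thesis using Conc by (simp add: push_succs_def)
  next
    case (Alt a b)
    have e: "end_at q (Suc s) = s + 1 + rpq_length a"
      using node_at_Alt[OF x(2) Alt] by (simp add: end_at_def sub_at_def)
    have "vc push_subs Q r m os (k + 2)"
      by (rule subs) (use e Alt Alt_less[OF x(2) Alt] in \<open>simp_all add: psucc_def\<close>)
    then show ?thesis using Alt by (simp add: push_succs_def)
  next
    case (Plus a)
    have "vc push_subs Q r m os (k + 2)"
      by (rule subs) (use Plus Plus_less[OF x(2) Plus] in \<open>simp_all add: psucc_def\<close>)
    then show ?thesis using Plus by (simp add: push_succs_def)
  qed
qed

lemma vc_expand_node:
  assumes s: "search r m Vis ws" and x: "v \<in> V" "s < n" "r 16 = v" "r 17 = s"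
    and Q: "\<And>r' m' ws' k'. search r' m' (set (psucc R q (v, s)) \<union> Vis) ws' \<Longrightarrow>
      set ws' = set ws \<union> (set (psucc R q (v, s)) - Vis) \<Longrightarrow>
      agree ({14..27} - {23}) r r' \<Longrightarrow>
      k' \<le> k + 50 + 17 * length (psucc R q (v, s)) \<Longrightarrow> Q r' m' os k'"
  shows "vc expand_node Q r m os k"
proof -
  note [simp] = const_regsD[OF search_const_regs[OF s]] x state_less_M[OF x(2) cont_at_le[OF x(2)]]
    read_symbol[OF x(2)]
  have m: "m (addr 1 s) = cont_at q s" "m (addr (Suc 0) s) = cont_at q s"
    using s x(2) by (auto simp: search_def tables_def)
  have "v < M" using node_less_W[OF x(1)] by (intro small_less_M) simp
  have "vc push_succs Q r' m os k'"
    if a: "search r' m Vis ws" "agree ({14..27} - {23}) r r'" "r' 16 = v" "r' 17 = s"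
      "r' 18 = sym (sub_at q s)" "r' 20 = v" "r' 25 = sym (sub_at q s) - 3" "r' 27 = cont_at q s"
      "k' \<le> k + 7" for r' k'
    by (rule vc_push_succs[OF a(1) x(1,2) a(3-8)]) (rule Q, use a in \<open>auto simp: agree_def\<close>)
  then show ?thesis unfolding expand_node_def block.simps using s \<open>v < M\<close>
    by (auto simp: m agree_def intro!: vc_get)
qed

lemma vc_expand_loop:
  assumes s: "search r m Vis ws" and x: "v \<in> V" "i < n" "r 16 = v" "r 26 = Suc i"
    and Q: "\<And>r' m' ws' k'. search r' m' (set (psucc R q (v, n + 1 + i)) \<union> Vis) ws' \<Longrightarrow>
      set ws' = set ws \<union> (set (psucc R q (v, n + 1 + i)) - Vis) \<Longrightarrow>
      agree ({14..27} - {23}) r r' \<Longrightarrow> k' \<le> k + 40 \<Longrightarrow> Q r' m' os k'"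
  shows "vc expand_loop Q r m os k"
proof -
  note cl = cont_at_le[OF x(2)]
  have iP: "(v, i + 1) \<in> P" using x(1,2) by (simp add: pstates_def)
  note [simp] = const_regsD[OF search_const_regs[OF s]] x state_less_M[OF x(2) cl]
  have ps: "psucc R q (v, n + 1 + i) = [(v, i + 1), (v, cont_at q i)]"
    by (simp add: psucc_def Let_def)
  have 2: "vc push Q r1 m1 os k1" if a: "search r1 m1 (insert (v, i + 1) Vis) ws1"
    "set ws1 = set ws \<union> ({(v, i + 1)} - Vis)" "agree ({14..27} - {23}) r r1" "k1 \<le> k + 20"
    "r1 20 = v" "r1 21 = cont_at q i" for r1 m1 ws1 k1
    by (rule vc_push[OF a(1), of "(v, cont_at q i)"])
      (use a cl ps in \<open>auto simp: pstates_def agree_def insert_commute intro!: Q\<close>)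
  have 1: "vc push (vc (get 1 21 26) (vc push Q)) r1 m os k1" if a: "search r1 m Vis ws"
    "agree {20, 21, 26} r r1" "k1 \<le> k + 3" "r1 20 = v" "r1 21 = Suc i" "r1 26 = i" for r1 k1
  proof (rule vc_push[OF a(1), of "(v, i + 1)"])
    show "(v, i + 1) \<in> P" by (rule iP)
    show "r1 20 = fst (v, i + 1)" "r1 21 = snd (v, i + 1)" using a by simp_all
    fix r' m' ws' k'
    assume b: "search r' m' (insert (v, i + 1) Vis) ws'" "set ws' = set ws \<union> ({(v, i + 1)} - Vis)"
      "agree {14, 22, 24, 25} r1 r'" "k' \<le> k1 + 13"
    have r': "r' 26 = i" "r' 20 = v" using a b(3) by (auto simp: agree_def)
    have "m' (addr 1 i) = cont_at q i" using b(1) x(2) by (simp add: search_def tables_def)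
    moreover have "vc push Q (r'(24 := addr 1 i, 21 := cont_at q i)) m' os (k' + 3)"
      using b a r' by (intro 2) (auto simp: agree_def)
    ultimately show "vc (get 1 21 26) (vc push Q) r' m' os k'"
      using const_regsD[OF search_const_regs[OF b(1)]] r' by (intro vc_get) auto
  qed
  show ?thesis unfolding expand_loop_def block.simps
    using s node_less_W[OF x(1)] small_less_M[of v] by (auto intro!: 1[unfolded One_nat_def])
qed

text \<open>The time is linear in the number of successors of the expanded state, so that it can be
  charged to this state.\<close>

lemma vc_expand:
  assumes s: "search r m Vis ws" and ne: "ws \<noteq> []"
    and Q: "\<And>r' m' ws' k'. search r' m' (set (psucc R q (last ws)) \<union> Vis) ws' \<Longrightarrow>
      set ws' = set (butlast ws) \<union> (set (psucc R q (last ws)) - Vis) \<Longrightarrow>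
      agree ({13..27} - {23}) r r' \<Longrightarrow> (r' 13 \<noteq> 0 \<longleftrightarrow> r 13 \<noteq> 0 \<or> snd (last ws) = n) \<Longrightarrow>
      k' \<le> k + 70 + 17 * length (psucc R q (last ws)) \<Longrightarrow> Q r' m' os k'"
  shows "vc expand Q r m os k"
proof -
  define x where "x = last ws"
  obtain v s where x: "x = (v, s)" by fastforce
  have "x \<in> P" using s ne last_in_set[OF ne] unfolding x_def search_def by blast
  then have v: "v \<in> V" and sn: "s \<le> 2 * n" by (auto simp: x pstates_def)
  define ws0 where "ws0 = butlast ws"
  have ws: "ws = ws0 @ [x]" using ne by (simp add: ws0_def x_def)
  note c = search_const_regs[OF s]
  have s0: "search r' m Vis ws0" if "const_regs r'" "r' 14 = length ws0" for r'
    using s that unfolding ws by (auto simp: search_def stack_def nth_append split: if_splits)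
  have st: "m (addr 3 (length ws0)) = code x" "r 14 = Suc (length ws0)"
    using s unfolding ws by (auto simp: search_def stack_def nth_append)
  have "length ws \<le> card P" using s card_mono[of P "set ws"]
    by (auto simp: search_def distinct_card)
  then have ad: "addr 3 (length ws0) < M" "length ws0 < M"
    using card_P_less[of "length ws0"] unfolding ws by (auto simp: addr_def)
  have cx: "code x < M" using code_less[OF \<open>x \<in> P\<close>] by (simp add: addr_def)
  have le: "v * width < M" "v < M" "s < M" "n - i < M" "s - i < M" "n < M" for i
    using cx sn n_less_W node_less_W[OF v] by (auto simp: code_def x intro!: small_less_M)
  have ce: "code x = v * width + s" by (simp add: code_def x)
  have dm: "i < width \<Longrightarrow> (v * width + i) div width = v" for i by simp
  have sw: "s < width" "n < width" using sn by (simp_all add: width_def)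
  have M: "0 < M" "1 < M" using small_less_M W_ge_2 by simp_all
  note [simp] = const_regsD[OF c] st ad cx[unfolded ce] ce le dm sw M M(2)[simplified]
  note Q' = Q[folded x_def, unfolded x snd_conv, folded ws0_def]
  have node: "vc expand_node Q r' m os k'" if "s < n" and a: "search r' m Vis ws0"
    "r' 16 = v" "r' 17 = s" "agree {14, 15, 16, 17, 24, 26} r r'" "k' \<le> k + 11" for r' k'
  proof (rule vc_expand_node[OF a(1) v \<open>s < n\<close> a(2,3)])
    fix r'' m'' ws'' k''
    assume b: "search r'' m'' (set (psucc R q (v, s)) \<union> Vis) ws''"
      "set ws'' = set ws0 \<union> (set (psucc R q (v, s)) - Vis)"
      "agree ({14..27} - {23}) r' r''" "k'' \<le> k' + 50 + 17 * length (psucc R q (v, s))"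
    show "Q r'' m'' os k''"
    proof (rule Q'[OF b(1,2)])
      show "agree ({13..27} - {23}) r r''" using a(4) b(3) by (auto simp: agree_def)
      show "(r'' 13 \<noteq> 0) = (r 13 \<noteq> 0 \<or> s = n)"
        using a(4) b(3) \<open>s < n\<close> by (simp add: agree_def)
    qed (use a(5) b(4) in linarith)
  qed
  have loop: "vc expand_loop Q r' m os k'" if "n < s" and a: "search r' m Vis ws0"
    "r' 16 = v" "r' 26 = s - n" "agree {14, 15, 16, 17, 24, 26} r r'" "k' \<le> k + 20" for r' k'
  proof (rule vc_expand_loop[OF a(1) v, of "s - n - 1"])
    have e: "n + 1 + (s - n - 1) = s" using \<open>n < s\<close> by simp
    show "s - n - 1 < n" "r' 16 = v" "r' 26 = Suc (s - n - 1)" using a sn \<open>n < s\<close> by auto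
    fix r'' m'' ws'' k''
    assume b: "search r'' m'' (set (psucc R q (v, n + 1 + (s - n - 1))) \<union> Vis) ws''"
      "set ws'' = set ws0 \<union> (set (psucc R q (v, n + 1 + (s - n - 1))) - Vis)"
      "agree ({14..27} - {23}) r' r''" "k'' \<le> k' + 40"
    show "Q r'' m'' os k''"
    proof (rule Q')
      show "search r'' m'' (set (psucc R q (v, s)) \<union> Vis) ws''"
        "set ws'' = set ws0 \<union> (set (psucc R q (v, s)) - Vis)" using b(1,2) unfolding e .
      show "agree ({13..27} - {23}) r r''" using a(4) b(3) by (auto simp: agree_def)
      show "(r'' 13 \<noteq> 0) = (r 13 \<noteq> 0 \<or> s = n)"
        using a(4) b(3) \<open>n < s\<close> by (simp add: agree_def)
    qed (use a(5) b(4) in linarith)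
  qed
  have final: "Q r' m os k'" if "s = n" and a: "search r' m Vis ws0"
    "r' 13 \<noteq> 0" "agree {13, 14, 15, 16, 17, 24, 26} r r'" "k' \<le> k + 20" for r' k'
  proof (rule Q')
    have "psucc R q (v, s) = []" using \<open>s = n\<close> by (simp add: psucc_def)
    then show "search r' m (set (psucc R q (v, s)) \<union> Vis) ws0"
      "set ws0 = set ws0 \<union> (set (psucc R q (v, s)) - Vis)" using a(1) by simp_all
    show "agree ({13..27} - {23}) r r'" using a(3) by (auto simp: agree_def)
    show "(r' 13 \<noteq> 0) = (r 13 \<noteq> 0 \<or> s = n)" using a(2) \<open>s = n\<close> by simp
  qed (use a(4) in linarith)
  show ?thesis unfolding expand_def block.simps
    using c by (auto intro!: vc_get s0 node loop final)
qed

end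

section \<open>Depth-first search\<close>

definition dfs :: com where
  "dfs = block [Arith Add 20 12 0, Arith Add 21 0 0, Arith Add 14 0 0, push, While 14 expand]"

context enum_run
begin

text \<open>The bound of \<open>vc_expand\<close> plus \<open>1\<close> for the test of the loop
  around it.\<close>

definition cost :: "nat \<times> nat \<Rightarrow> nat" where
  "cost x = 71 + 17 * length (psucc R q x)"

definition reach :: "nat \<Rightarrow> (nat \<times> nat) set" where
  "reach u = {x. ((u, 0), x) \<in> (prel R q)\<^sup>*}"

lemma reach_start: "(u, 0) \<in> reach u"
  by (simp add: reach_def)

lemma reach_step: "x \<in> reach u \<Longrightarrow> y \<in> set (psucc R q x) \<Longrightarrow> y \<in> reach u"
  unfolding reach_def mem_Collect_eq by (rule rtrancl_into_rtrancl) (simp_all add: prel_iff)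

lemma reach_subset:
  assumes "(u, 0) \<in> X" "\<And>x. x \<in> X \<Longrightarrow> set (psucc R q x) \<subseteq> X"
  shows "reach u \<subseteq> X"
proof
  fix x assume "x \<in> reach u"
  then have "((u, 0), x) \<in> (prel R q)\<^sup>*" by (simp add: reach_def)
  then show "x \<in> X" by (induction rule: rtrancl_induct) (use assms in \<open>auto simp: prel_iff\<close>)
qed

lemma reach_P: "u \<in> V \<Longrightarrow> reach u \<subseteq> P"
  by (rule reach_subset) (use psucc_pstates in \<open>auto simp: pstates_def\<close>)

text \<open>Skipping \<open>Dead\<close> is harmless: it is closed, so no state outside it is missed
  by not entering it, and it has no final state, so the flag still tells whether
  \<open>reach u\<close> has one. Only states not in \<open>Dead\<close> are paid for;
  \<open>sum cost Dead\<close> stands on the left to avoid truncated subtraction.\<close>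

lemma vc_dfs:
  assumes r: "const_regs r" "r 12 = u" "u \<in> V" "r 13 = 0"
    and m: "tables m" "marks m Dead"
    and Dead: "Dead \<subseteq> P" "\<And>x. x \<in> Dead \<Longrightarrow> set (psucc R q x) \<subseteq> Dead" "\<And>v. (v, n) \<notin> Dead"
    and Q: "\<And>r' m' k'. const_regs r' \<Longrightarrow> tables m' \<Longrightarrow> marks m' (Dead \<union> reach u) \<Longrightarrow>
      (r' 13 \<noteq> 0 \<longleftrightarrow> (\<exists>v. (v, n) \<in> reach u)) \<Longrightarrow> agree ({13..27} - {23}) r r' \<Longrightarrow>
      k' + sum cost Dead \<le> k + 20 + sum cost (Dead \<union> reach u) \<Longrightarrow> Q r' m' os k'"
  shows "vc dfs Q r m os k"
proof -
  \<comment> \<open>\<open>Vis - set ws\<close> consists of \<open>Dead\<close> and the states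
    expanded so far. Closure, flag and time refer to this set, and the variant counts its complement
    in the product.\<close>
  define I where "I x r1 m1 os1 k1 \<longleftrightarrow> os1 = os \<and> (\<exists>Vis ws. search r1 m1 Vis ws \<and>
      insert (u, 0) Dead \<subseteq> Vis \<and> Vis \<subseteq> Dead \<union> reach u \<and> set ws \<inter> Dead = {} \<and>
      (\<forall>y \<in> Vis - set ws. set (psucc R q y) \<subseteq> Vis) \<and>
      (r1 13 \<noteq> 0 \<longleftrightarrow> (\<exists>v. (v, n) \<in> Vis - set ws)) \<and> agree ({13..27} - {23}) r r1 \<and>
      k1 + sum cost Dead \<le> k + 16 + sum cost (Vis - set ws) \<and> x = card (P - (Vis - set ws)))"
    for x r1 m1 os1 k1
  have loop: "vc (While 14 expand) Q r1 m1 os1 k1" if "I x r1 m1 os1 k1" for x r1 m1 os1 k1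
  proof (rule vc_While[where I = I, OF that])
    fix x r1 m1 os1 k1
    assume "I x r1 m1 os1 k1" "r1 14 \<noteq> 0"
    then obtain Vis ws where os: "os1 = os" and s: "search r1 m1 Vis ws"
      and Vis: "insert (u, 0) Dead \<subseteq> Vis" "Vis \<subseteq> Dead \<union> reach u" "set ws \<inter> Dead = {}"
      and cl: "\<forall>y \<in> Vis - set ws. set (psucc R q y) \<subseteq> Vis"
      and fin: "r1 13 \<noteq> 0 \<longleftrightarrow> (\<exists>v. (v, n) \<in> Vis - set ws)"
      and ag: "agree ({13..27} - {23}) r r1"
      and k1: "k1 + sum cost Dead \<le> k + 16 + sum cost (Vis - set ws)"
      and x: "x = card (P - (Vis - set ws))"
      unfolding I_def by blast
    have ne: "ws \<noteq> []" using s \<open>r1 14 \<noteq> 0\<close> by (auto simp: search_def)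
    define y where "y = last ws"
    have wse: "butlast ws @ [y] = ws" using append_butlast_last_id[OF ne] by (simp only: y_def)
    have "distinct (butlast ws @ [y])" unfolding wse using s by (simp add: search_def)
    moreover have "set (butlast ws @ [y]) = set ws" unfolding wse ..
    ultimately have y: "y \<in> set ws" "y \<notin> set (butlast ws)" "set ws = insert y (set (butlast ws))"
      by auto
    have sub: "set ws \<subseteq> Vis" "Vis \<subseteq> P" using s by (auto simp: search_def)
    show "vc expand (\<lambda>r m os k. \<exists>y < x. I y r m os k) r1 m1 os1 (k1 + 1)"
    proof (rule vc_expand[OF s ne], fold y_def)
      fix r' m' ws' k'
      assume a: "search r' m' (set (psucc R q y) \<union> Vis) ws'"
        "set ws' = set (butlast ws) \<union> (set (psucc R q y) - Vis)"
        "agree ({13..27} - {23}) r1 r'" "(r' 13 \<noteq> 0) = (r1 13 \<noteq> 0 \<or> snd y = n)"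
        "k' \<le> k1 + 1 + 70 + 17 * length (psucc R q y)"
      let ?V = "set (psucc R q y) \<union> Vis"
      have ydead: "y \<notin> Dead" using y(1) Vis(3) by blast
      \<comment> \<open>Newly marked successors are all on the stack, so \<open>y\<close> is the
        only state that joins the expanded ones.\<close>
      have done': "?V - set ws' = insert y (Vis - set ws)" using a(2) y sub by auto
      have P': "?V \<subseteq> P" using a(1) by (simp add: search_def)
      have "card (P - (?V - set ws')) < x"
        unfolding x done' by (rule psubset_card_mono) (use y(1) sub in auto)
      moreover have "I (card (P - (?V - set ws'))) r' m' os1 k'"
        unfolding I_def
      proof (intro conjI exI[of _ ?V] exI[of _ ws'])
        show "os1 = os" by (rule os)
        show "search r' m' ?V ws'" by (rule a(1))
        show "insert (u, 0) Dead \<subseteq> ?V" using Vis(1) by blast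
        have "y \<in> reach u" using y(1) sub Vis(2) ydead by blast
        then show "?V \<subseteq> Dead \<union> reach u" using Vis(2) reach_step by blast
        show "set ws' \<inter> Dead = {}" using a(2) Vis(1,3) y(3) by auto
        show "\<forall>z \<in> ?V - set ws'. set (psucc R q z) \<subseteq> ?V" unfolding done' using cl by blast
        show "(r' 13 \<noteq> 0) = (\<exists>v. (v, n) \<in> ?V - set ws')"
          unfolding done' a(4) fin by (cases y) auto
        show "agree ({13..27} - {23}) r r'" using ag a(3) agree_trans by blast
        have "sum cost (?V - set ws') = cost y + sum cost (Vis - set ws)"
          unfolding done' using y(1) finite_subset[OF sub(2)] by (simp add: sum.insert_if)
        then show "k' + sum cost Dead \<le> k + 16 + sum cost (?V - set ws')"
          using k1 a(5) by (simp add: cost_def)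
      qed simp
      ultimately show "\<exists>z < x. I z r' m' os1 k'" by blast
    qed
  next
    fix x r1 m1 os1 k1
    assume "I x r1 m1 os1 k1" "r1 14 = 0"
    then obtain Vis ws where os: "os1 = os" and s: "search r1 m1 Vis ws"
      and Vis: "insert (u, 0) Dead \<subseteq> Vis" "Vis \<subseteq> Dead \<union> reach u"
      and cl': "\<forall>y \<in> Vis - set ws. set (psucc R q y) \<subseteq> Vis"
      and fin': "r1 13 \<noteq> 0 \<longleftrightarrow> (\<exists>v. (v, n) \<in> Vis - set ws)"
      and ag: "agree ({13..27} - {23}) r r1"
      and k1': "k1 + sum cost Dead \<le> k + 16 + sum cost (Vis - set ws)"
      unfolding I_def by blast
    have "Vis - set ws = Vis" using s \<open>r1 14 = 0\<close> by (auto simp: search_def)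
    note cl = cl'[unfolded this] and fin = fin'[unfolded this] and k1 = k1'[unfolded this]
    have "reach u \<subseteq> Vis" by (rule reach_subset) (use Vis cl in auto)
    then have V: "Vis = Dead \<union> reach u" using Vis by blast
    show "Q r1 m1 os1 (k1 + 1)" unfolding os
    proof (rule Q)
      show "const_regs r1" "tables m1" "marks m1 (Dead \<union> reach u)"
        using s V by (simp_all add: search_def)
      show "(r1 13 \<noteq> 0) = (\<exists>v. (v, n) \<in> reach u)" unfolding fin V using Dead(3) by blast
    qed (use ag k1 V in simp_all)
  qed
  have init: "vc push (vc (While 14 expand) Q) r1 m os (k + 3)"
    if a: "agree {14, 20, 21} r r1" "r1 14 = 0" "r1 20 = u" "r1 21 = 0" for r1
  proof (rule vc_push)
    have "const_regs r1" using const_regs_agree[OF r(1) a(1)] by simp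
    then show "search r1 m Dead []" using m Dead(1) a by (simp add: search_def stack_def)
    show "(u, 0) \<in> P" using r(3) by (simp add: pstates_def)
    show "r1 20 = fst (u, 0 :: nat)" "r1 21 = snd (u :: nat, 0)" using a by simp_all
    fix r' m' ws' k'
    assume b: "search r' m' (insert (u, 0) Dead) ws'" "set ws' = set [] \<union> ({(u, 0)} - Dead)"
      "agree {14, 22, 24, 25} r1 r'" "k' \<le> k + 3 + 13"
    \<comment> \<open>If \<open>(u, 0)\<close> is dead, nothing is pushed and the loop ends at once.
      In either case exactly \<open>Dead\<close> counts as expanded.\<close>
    have d: "insert (u, 0) Dead - set ws' = Dead" using b(2) by auto
    show "vc (While 14 expand) Q r' m' os k'"
    proof (rule loop[of "card (P - (insert (u, 0) Dead - set ws'))"], unfold I_def,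
        intro conjI exI[of _ "insert (u, 0) Dead"] exI[of _ ws'])
      show "insert (u, 0) Dead \<subseteq> Dead \<union> reach u" using reach_start by blast
      show "set ws' \<inter> Dead = {}" using b(2) by auto
      show "\<forall>y \<in> insert (u, 0) Dead - set ws'. set (psucc R q y) \<subseteq> insert (u, 0) Dead"
        unfolding d using Dead(2) by blast
      have "r' 13 = 0" using b(3) a(1) r(4) by (simp add: agree_def)
      then show "(r' 13 \<noteq> 0) = (\<exists>v. (v, n) \<in> insert (u, 0) Dead - set ws')"
        unfolding d using Dead(3) by simp
      show "agree ({13..27} - {23}) r r'" using b(3) a(1) by (auto simp: agree_def)
      show "k' + sum cost Dead \<le> k + 16 + sum cost (insert (u, 0) Dead - set ws')"
        unfolding d using b(4) by simp
    qed (use b(1) in simp_all)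
  qed
  have "u < M" "0 < M" using node_less_W[OF r(3)] by (auto intro!: small_less_M)
  moreover have "vc push (vc (While 14 expand) Q) (r(20 := u, 21 := 0, 14 := 0)) m os (k + 1 + 1 + 1)"
    using init[of "r(20 := u, 21 := 0, 14 := 0)"] by (simp add: agree_def eval_nat_numeral)
  ultimately show ?thesis unfolding dfs_def block.simps using const_regsD[OF r(1)] r(2) by simp
qed

end

section \<open>Clearing marks and listing marked nodes\<close>

definition clear_state :: com where
  "clear_state = block [put 2 22 0, Arith Add 22 22 1, Arith Sub 21 21 1]"

definition advance :: "nat \<Rightarrow> com" where
  "advance p = block [Arith Add 25 p 1, Read p 25]"

text \<open>The codes of the states at one node form a block of \<open>width\<close> consecutive
  numbers. Walking through the blocks of the listed nodes keeps the time proportional to the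
  product, although the blocks may lie far apart.\<close>

definition clear_node :: com where
  "clear_node = block [Read 20 19, Arith Mul 22 20 9, Arith Add 21 9 0, While 21 clear_state, advance 19]"

definition clear :: com where
  "clear = block [Read 19 1, While 19 clear_node]"

definition scan_node :: com where
  "scan_node = block [Read 20 19, Arith Mul 22 20 9, Arith Add 22 22 5, get 2 25 22,
     If 25 (Output 12 20) Skip, advance 19]"

definition scan :: com where
  "scan = block [Read 19 1, While 19 scan_node]"

context enum_run
begin

text \<open>Zeroing any mark preserves this property, so the loops can be verified without
  injectivity of \<open>code\<close> on pairs outside the product; \<open>marks\<close> appears only
  at the end.\<close>

definition cleared :: "(nat \<Rightarrow> nat) \<Rightarrow> (nat \<times> nat) set \<Rightarrow> bool" where
  "cleared m X \<longleftrightarrow> tables m \<and> (\<forall>x \<in> X. m (addr 2 (code x)) = 0)"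

lemma cleared_marks: "cleared m X \<Longrightarrow> P \<subseteq> X \<Longrightarrow> marks m {}"
  by (auto simp: cleared_def marks_def)

lemma cleared_insert: "cleared m X \<Longrightarrow> cleared (m(addr 2 (code x) := 0)) (insert x X)"
  by (auto simp: cleared_def tables_def)

lemma block_less:
  assumes "v \<in> V" "i \<le> (v + 1) * width"
  shows "addr 3 i < M"
proof -
  have "(v + 1) * width \<le> W * (2 * W)" using node_less_W[OF assms(1)] n_less_W
    by (intro mult_le_mono) (auto simp: width_def)
  then show ?thesis using assms(2) M_bound by (simp add: addr_def)
qed

lemma vc_clear_states:
  assumes "const_regs r" "cleared m X" "v \<in> V" "r 21 + j = width" "r 22 = v * width + j"
    and "\<And>r' m'. cleared m' (X \<union> {v} \<times> {j..<width}) \<Longrightarrow> agree {21, 22, 24} r r' \<Longrightarrow>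
      Q r' m' os (k + 6 * r 21 + 1)"
  shows "vc (While 21 clear_state) Q r m os k"
  using assms
proof (induction "r 21" arbitrary: r m X j k)
  case 0
  have r: "r 21 = 0" using 0(1) by simp
  then have "j = width" using 0(5) by simp
  then have "cleared m (X \<union> {v} \<times> {j..<width})" using 0(3) by simp
  then have "Q r m os (k + 6 * r 21 + 1)" by (rule 0(7)) (rule agree_refl)
  then show ?case using r by (auto intro: wp_While_False)
next
  case (Suc l)
  have r: "r 21 = Suc l" using Suc(2) by simp
  have jw: "Suc (l + j) = width" using Suc(6) r by simp
  define Y where "Y = wp (While 21 clear_state) Q"
  let ?r = "r(24 := addr 2 (code (v, j)), 22 := v * width + Suc j, 21 := l)"
  let ?m = "m(addr 2 (code (v, j)) := 0)"
  have l: "l < M" "Suc (v * width + j) < M" "addr 3 (v * width + j) < M"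
  proof -
    have j: "Suc j \<le> width" "l \<le> width" using jw by auto
    then show "Suc (v * width + j) < M" "addr 3 (v * width + j) < M"
      using block_less[OF Suc(5), of "Suc (v * width + j)"] by (auto simp: addr_def)
    show "l < M" using block_less[OF Suc(5), of l] j by (simp add: addr_def)
  qed
  have "vc (While 21 clear_state) Q ?r ?m os (k + 6)"
  proof (rule Suc(1)[where X = "insert (v, j) X" and j = "Suc j"])
    show "l = ?r 21" by simp
    show "const_regs ?r" using Suc(3) by simp
    show "cleared ?m (insert (v, j) X)" by (rule cleared_insert[OF Suc(4)])
    show "v \<in> V" by (rule Suc(5))
    show "?r 21 + Suc j = width" using jw by simp
    show "?r 22 = v * width + Suc j" by simp
    fix r' m'
    assume a: "cleared m' (insert (v, j) X \<union> {v} \<times> {Suc j..<width})" "agree {21, 22, 24} ?r r'"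
    have "{j..<width} = insert j {Suc j..<width}" using jw by auto
    then have "cleared m' (X \<union> {v} \<times> {j..<width})" using a(1) by simp
    moreover have "agree {21, 22, 24} r r'" using a(2) by (simp add: agree_def)
    ultimately have "Q r' m' os (k + 6 * r 21 + 1)" by (rule Suc(8))
    then show "Q r' m' os (k + 6 + 6 * ?r 21 + 1)" by (simp add: r algebra_simps)
  qed
  then have "Y ?r ?m os (k + 6)" by (simp add: Y_def)
  then have "vc clear_state Y r m os (k + 1)"
    unfolding clear_state_def block.simps using const_regsD[OF Suc(3)] r Suc(7) l
    by (auto simp: code_def fun_upd_twist add.commute[of k] intro!: vc_put)
  then show ?case using r by (simp add: wp_While_True vc_imp_wp Y_def)
qed

lemma vc_clear_nodes:
  assumes "const_regs r" "cleared m X" "list_at inp (r 19) vs" "set vs \<subseteq> V" "r 19 < W"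
    and "\<And>r' m'. cleared m' (X \<union> set vs \<times> {..<width}) \<Longrightarrow> agree ({14..27} - {23}) r r' \<Longrightarrow>
      Q r' m' os (k + (6 * width + 7) * length vs + 1)"
  shows "vc (While 19 clear_node) Q r m os k"
  using assms
proof (induction vs arbitrary: r m X k)
  case Nil
  then have "r 19 = 0" using list_at_nonzero by fastforce
  moreover have "Q r m os (k + 1)" using Nil.prems(6)[of m r] Nil.prems(2) by auto
  ultimately show ?case by (auto intro: wp_While_False)
next
  case (Cons v vs)
  have r19: "r 19 \<noteq> 0" using Cons.prems(3) list_at_0 by (metis list.distinct(1))
  then have v: "inp (r 19) = v" "list_at inp (inp (r 19 + 1)) vs"
    using Cons.prems(3) list_at_nonzero by auto
  have vV: "v \<in> V" using Cons.prems(4) by simp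
  define Y where "Y = wp (While 19 clear_node) Q"
  have M: "v * width < M" "width < M" "Suc (r 19) < M" "v < M"
    using block_less[OF vV, of "v * width"] block_less[OF vV, of width] Cons.prems(5) W_ge_2
      node_less_W[OF vV] by (auto simp: addr_def intro!: small_less_M)
  note [simp] = const_regsD[OF Cons.prems(1)] M v
  have states: "vc (While 21 clear_state) (vc (advance 19) Y) r1 m os k1"
    if a: "agree {20, 21, 22} r r1" "r1 21 = width" "r1 22 = v * width" "k1 = k + 4" for r1 k1
  proof (rule vc_clear_states[where X = X and v = v and j = 0])
    show "const_regs r1" using const_regs_agree[OF Cons.prems(1) a(1)] by simp
    fix r' m'
    assume b: "cleared m' (X \<union> {v} \<times> {0..<width})" "agree {21, 22, 24} r1 r'"
    have r': "r' 19 = r 19" "r' (Suc 0) = 1" "r' 1 = 1"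
      using a(1) b(2) by (simp_all add: agree_def)
    let ?r = "r'(25 := Suc (r 19), 19 := inp (Suc (r 19)))"
    have ag: "agree ({14..27} - {23}) r ?r" using a(1) b(2) by (auto simp: agree_def)
    have "vc (While 19 clear_node) Q ?r m' os (k + 7 + 6 * width)"
    proof (rule Cons.IH[where X = "X \<union> {v} \<times> {..<width}"])
      show "const_regs ?r" by (rule const_regs_agree[OF Cons.prems(1) ag]) auto
      show "cleared m' (X \<union> {v} \<times> {..<width})" using b(1) by (simp add: atLeast0LessThan)
      show "list_at inp (?r 19) vs" using v(2) by simp
      show "set vs \<subseteq> V" using Cons.prems(4) by simp
      show "?r 19 < W" using inp_less_W by simp
      fix r'' m''
      assume c: "cleared m'' (X \<union> {v} \<times> {..<width} \<union> set vs \<times> {..<width})"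
        "agree ({14..27} - {23}) ?r r''"
      have "cleared m'' (X \<union> set (v # vs) \<times> {..<width})"
        using c(1) by (simp add: Un_assoc flip: Sigma_Un_distrib1)
      then show "Q r'' m'' os (k + 7 + 6 * width + (6 * width + 7) * length vs + 1)"
        using Cons.prems(6)[of m'' r''] agree_trans[OF ag c(2)] by (simp add: algebra_simps)
    qed
    then show "vc (advance 19) Y r' m' os (k1 + 6 * r1 21 + 1)"
      using a(2,4) r' by (simp add: Y_def advance_def algebra_simps)
  qed (use a Cons.prems vV in simp_all)
  have "vc clear_node Y r m os (k + 1)"
    unfolding clear_node_def block.simps by (auto intro!: states[unfolded vc.simps(10)])
  then show ?case using r19 by (simp add: wp_While_True vc_imp_wp Y_def)
qed

lemma vc_clear:
  assumes "const_regs r" "tables m"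
    and "\<And>r' m'. tables m' \<Longrightarrow> marks m' {} \<Longrightarrow> agree ({14..27} - {23}) r r' \<Longrightarrow>
      Q r' m' os (k + (6 * width + 7) * length (node_list R) + 2)"
  shows "vc clear Q r m os k"
proof -
  have "vc (While 19 clear_node) Q (r(19 := inp 1)) m os (k + 1)"
  proof (rule vc_clear_nodes[where X = "{}" and vs = "node_list R"])
    show "cleared m {}" using assms(2) by (simp add: cleared_def)
    show "list_at inp ((r(19 := inp 1)) 19) (node_list R)" using list_at_nodes by simp
    fix r' m'
    assume a: "cleared m' ({} \<union> V \<times> {..<width})" "agree ({14..27} - {23}) (r(19 := inp 1)) r'"
    have "P \<subseteq> {} \<union> V \<times> {..<width}" by (auto simp: pstates_def width_def)
    then have "marks m' {}" using cleared_marks a(1) by blast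
    moreover have "tables m'" using a(1) by (simp add: cleared_def)
    moreover have "agree ({14..27} - {23}) r r'" using a(2) by (simp add: agree_def)
    ultimately show "Q r' m' os (k + 1 + (6 * width + 7) * length (node_list R) + 1)"
      using assms(3) by simp
  qed (use assms(1) inp_less_W in simp_all)
  then show ?thesis unfolding clear_def block.simps using const_regsD[OF assms(1)] by simp
qed

text \<open>One hit restarts the clock, so the final time then no longer depends on
  \<open>k\<close>; a successful round thereby settles the time accumulated before it. A node costs
  \<open>11\<close>: loop test, three instructions for the code, \<open>3\<close> for
  \<open>get\<close>, test, output or skip, and \<open>2\<close> to advance.\<close>

lemma vc_scan_nodes:
  assumes "const_regs r" "marks m Vis" "r 12 = u" "list_at inp (r 19) vs" "set vs \<subseteq> V" "r 19 < W"
    and "k + 11 * length vs \<le> B" "11 \<le> B"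
    and "\<And>r' k'. agree ({14..27} - {23}) r r' \<Longrightarrow>
      k' \<le> (if \<exists>v \<in> set vs. (v, n) \<in> Vis then 0 else k) + 11 * length vs + 1 \<Longrightarrow>
      Q r' m (os @ map (Pair u) (filter (\<lambda>v. (v, n) \<in> Vis) vs)) k'"
  shows "vc (While 19 scan_node) Q r m os k"
  using assms
proof (induction vs arbitrary: r os k)
  case Nil
  then have "r 19 = 0" using list_at_nonzero by fastforce
  moreover have "Q r m os (k + 1)" using Nil.prems(9)[of r "k + 1"] by auto
  ultimately show ?case by (auto intro: wp_While_False)
next
  case (Cons v vs)
  have r19: "r 19 \<noteq> 0" using Cons.prems(4) list_at_0 by (metis list.distinct(1))
  then have v: "inp (r 19) = v" "list_at inp (inp (r 19 + 1)) vs"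
    using Cons.prems(4) list_at_nonzero by auto
  have vV: "v \<in> V" using Cons.prems(5) by simp
  then have vP: "(v, n) \<in> P" by (simp add: pstates_def)
  define Y where "Y = wp (While 19 scan_node) Q"
  have M: "v * width < M" "addr 3 (v * width + n) < M" "v * width + n < M" "Suc (r 19) < M" "v < M" "1 < M" "0 < M"
    using code_less[OF vP] Cons.prems(6) W_ge_2
      node_less_W[OF vV] by (auto simp: addr_def code_def intro!: small_less_M)
  have mark: "m (addr 2 (v * width + n)) = (if (v, n) \<in> Vis then 1 else 0)"
    using Cons.prems(2) vP by (auto simp: marks_def code_def)
  note [simp] = const_regsD[OF Cons.prems(1)] M M(6)[simplified] v mark Cons.prems(3)
  have next_node: "vc (advance 19) Y r1 m (os @ os1) k1"
    if a: "agree ({14..27} - {19, 23}) r r1"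
      "os1 = map (Pair u) (filter (\<lambda>v. (v, n) \<in> Vis) [v])"
      "k1 \<le> (if (v, n) \<in> Vis then 0 else k) + 9" for r1 os1 k1
  proof -
    have r': "r1 19 = r 19" "r1 (Suc 0) = 1" "r1 1 = 1"
      using a(1) by (simp_all add: agree_def)
    let ?r = "r1(25 := Suc (r 19), 19 := inp (Suc (r 19)))"
    have ag: "agree ({14..27} - {23}) r ?r" using a(1) by (auto simp: agree_def)
    have "vc (While 19 scan_node) Q ?r m (os @ os1) (k1 + 2)"
    proof (rule Cons.IH)
      show "const_regs ?r" by (rule const_regs_agree[OF Cons.prems(1) ag]) auto
      show "?r 12 = u" using agreeD[OF ag, of 12] by simp
      show "list_at inp (?r 19) vs" using v(2) by simp
      show "set vs \<subseteq> V" using Cons.prems(5) by simp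
      show "?r 19 < W" using inp_less_W by simp
      show "k1 + 2 + 11 * length vs \<le> B" using a(3) Cons.prems(7) by (simp split: if_splits)
      fix r' k'
      assume b: "agree ({14..27} - {23}) ?r r'"
        "k' \<le> (if \<exists>v \<in> set vs. (v, n) \<in> Vis then 0 else k1 + 2) + 11 * length vs + 1"
      have "k' \<le> (if \<exists>v \<in> set (v # vs). (v, n) \<in> Vis then 0 else k) + 11 * length (v # vs) + 1"
        using b(2) a(3) by (simp split: if_splits)
      then show "Q r' m ((os @ os1) @ map (Pair u) (filter (\<lambda>v. (v, n) \<in> Vis) vs)) k'"
        using Cons.prems(9)[of r' k'] agree_trans[OF ag b(1)] a(2) by (simp split: if_splits)
    qed (use Cons.prems in simp_all)
    then show ?thesis using r' by (simp add: Y_def advance_def)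
  qed
  have test: "vc (If 25 (Output 12 20) Skip) (vc (advance 19) Y) r1 m os k1"
    if a: "agree {20, 22, 24, 25} r r1" "r1 20 = v" "r1 25 = (if (v, n) \<in> Vis then 1 else 0)"
      "k1 = k + 7" for r1 k1
  proof (cases "(v, n) \<in> Vis")
    case True
    have "agree ({14..27} - {19, 23}) r r1" using a(1) by (auto simp: agree_def)
    then have "vc (advance 19) Y r1 m (os @ [(u, v)]) 0"
      using True by (intro next_node) auto
    moreover have "r1 12 = u" using agreeD[OF a(1), of 12] by simp
    moreover have "k + 9 \<le> B" using Cons.prems(7) by simp
    ultimately show ?thesis using a(2-4) True by simp
  next
    case False
    have "agree ({14..27} - {19, 23}) r r1" using a(1) by (auto simp: agree_def)
    then have "vc (advance 19) Y r1 m (os @ []) (k + 9)"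
      using False by (intro next_node) auto
    then show ?thesis using a(2-4) False by (simp add: add.commute[of k])
  qed
  have "vc scan_node Y r m os (k + 1)"
    unfolding scan_node_def block.simps
    by (auto simp del: vc.simps(9) intro!: vc_get test)
  then show ?case using r19 by (simp add: wp_While_True vc_imp_wp Y_def)
qed

lemma vc_scan:
  assumes "const_regs r" "marks m Vis" "r 12 = u"
    and "k + 11 * length (node_list R) + 1 \<le> B" "11 \<le> B"
    and "\<exists>v \<in> V. (v, n) \<in> Vis"
    and Q: "\<And>r' k'. agree ({14..27} - {23}) r r' \<Longrightarrow> k' \<le> 11 * length (node_list R) + 1 \<Longrightarrow>
      Q r' m (os @ map (Pair u) (filter (\<lambda>v. (v, n) \<in> Vis) (node_list R))) k'"
  shows "vc scan Q r m os k"
proof -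
  have "vc (While 19 scan_node) Q (r(19 := inp 1)) m os (k + 1)"
  proof (rule vc_scan_nodes[where Vis = Vis and u = u and vs = "node_list R"])
    show "list_at inp ((r(19 := inp 1)) 19) (node_list R)" using list_at_nodes by simp
    fix r' k'
    assume a: "agree ({14..27} - {23}) (r(19 := inp 1)) r'"
      "k' \<le> (if \<exists>v \<in> V. (v, n) \<in> Vis then 0 else k + 1) + 11 * length (node_list R) + 1"
    have "agree ({14..27} - {23}) r r'" using a(1) by (simp add: agree_def)
    then show "Q r' m (os @ map (Pair u) (filter (\<lambda>v. (v, n) \<in> Vis) (node_list R))) k'"
      using Q a(2) assms(6) by simp
  qed (use assms inp_less_W in simp_all)
  then show ?thesis unfolding scan_def block.simps using const_regsD[OF assms(1)] by simp
qed

end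

section \<open>Tables of the automaton\<close>

definition init :: "nat \<Rightarrow> com" where
  "init sigma = block [Const 0 0, Const 1 1, Const 2 2, Const 3 3, Const 4 4, Read 5 3, Read 6 2,
     Read 7 4, Const 8 sigma, Arith Add 9 5 5, Arith Add 9 9 2]"

text \<open>The first lookup gives the end of the first operand. \<open>3\<close> minus the symbol
  is nonzero just for the binary operators, where this end is the start of the second operand and is
  looked up once more.\<close>

definition end_children :: com where
  "end_children = block [get 0 20 20, Arith Sub 25 3 18, If 25 (get 0 20 20) Skip]"

definition end_node :: com where
  "end_node = block [Arith Sub 14 14 1, Arith Add 25 6 14, Read 18 25, Arith Add 20 14 1,
     Arith Sub 25 18 3, If 25 Skip (If 18 end_children Skip), put 0 14 20]"

text \<open>The end of a position depends on ends of positions to its right, so the pass runs from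
  right to left.\<close>

definition ends :: com where
  "ends = block [Arith Add 14 5 0, While 14 end_node]"

definition cont_children :: com where
  "cont_children = block [get 0 21 20, Arith Sub 25 18 1,
     If 25
       (block [Arith Sub 25 18 2,
          If 25
            (block [Arith Add 22 5 20, put 1 20 22])
            (block [put 1 20 27, put 1 21 27])])
       (block [put 1 20 21, put 1 21 27])]"

definition cont_next :: com where
  "cont_next = block [Arith Add 14 14 1, Arith Sub 26 5 14]"

definition cont_node :: com where
  "cont_node = block [Arith Add 25 6 14, Read 18 25, get 1 27 14, Arith Add 20 14 1,
     Arith Sub 25 18 3, If 25 Skip (If 18 cont_children Skip), cont_next]"

text \<open>Each position enters the continuations of its children, so the pass runs from left to
  right and only the entry of the root is set in advance.\<close>

definition conts :: com where
  "conts = block [put 1 0 5, Arith Add 14 0 0, Arith Sub 26 5 14, While 26 cont_node]"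

context enum_run
begin

lemma vc_init:
  assumes "\<And>r'. const_regs r' \<Longrightarrow> Q r' m os (k + 11)"
  shows "vc (init sigma) Q r m os k"
proof -
  have "inp 3 = n" using stores by (simp add: stores_def)
  moreover have "sigma \<le> sigma * W" "2 * W \<le> W * W" using W_ge_2 by simp_all
  then have "sigma < M" "n + n < M" "2 * n + 2 < M" "4 < M"
    using M_bound n_less_W W_ge_2 unfolding add_mult_distrib by linarith+
  moreover note assms
  ultimately show ?thesis
    by (auto simp: init_def const_regs_def width_def mult_2 eval_nat_numeral intro!: assms)
qed

lemma vc_end_node:
  assumes r: "const_regs r" "r 14 = Suc i" "i < n"
    and m: "\<And>j. i < j \<Longrightarrow> j < n \<Longrightarrow> m (addr 0 j) = end_at q j"
    and Q: "\<And>r' k'. agree {14, 18, 20, 24, 25} r r' \<Longrightarrow> r' 14 = i \<Longrightarrow> k' \<le> k + 20 \<Longrightarrow>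
      Q r' (m(addr 0 i := end_at q i)) os k'"
  shows "vc end_node Q r m os k"
proof -
  note [simp] = const_regsD[OF r(1)] r(2,3) read_symbol[OF r(3)] state_less_M[OF r(3), of 0]
  have M: "1 < M" "Suc 0 < M" "2 < M" "3 < M" using small_less_M W_ge_2 by simp_all
  note [simp] = M
  have fin: "vc (put 0 14 20) Q r' m os k'" if "agree {14, 18, 20, 24, 25} r r'" "r' 14 = i"
    "r' 20 = end_at q i" "k' \<le> k + 17" for r' k'
  proof (rule vc_put)
    show "r' 4 = 4" "r' 0 = 0" using that(1) by (simp_all add: agree_def)
    show "Q (r'(24 := addr 0 (r' 14))) (m(addr 0 (r' 14) := r' 20)) os (k' + 3)"
      unfolding that(2,3) using that by (intro Q) auto
  qed (use that in simp_all)
  have child: "Suc i < n \<and> m (addr 0 (Suc i)) = end_at q (Suc i)" if "Suc i < n"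
    using m that by simp
  have children: "vc end_children (vc (put 0 14 20) Q) r' m os k'"
    if a: "agree {14, 18, 20, 25} r r'" "r' 14 = i" "r' 20 = Suc i" "r' 18 = sym (sub_at q i)" "k' \<le> k + 7"
      and b: "Suc i < n" "if sym (sub_at q i) = 3 then end_at q (Suc i) = end_at q i
        else sym (sub_at q i) \<in> {1, 2} \<and> end_at q (Suc i) < n \<and> i < end_at q (Suc i) \<and>
          end_at q (end_at q (Suc i)) = end_at q i" for r' k'
  proof -
    have r': "r' 0 = 0" "r' 3 = 3" "r' 4 = 4" using a(1) by (simp_all add: agree_def)
    have e: "m (addr 0 (Suc i)) = end_at q (Suc i)" using m b(1) by simp
    have ad: "addr 3 (Suc i) < M" using state_less_M(3)[OF b(1), of 0] by simp
    have eM: "end_at q (Suc i) < M"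
      using end_at_le[OF b(1)] n_less_W by (intro small_less_M) simp
    show ?thesis
    proof (cases "sym (sub_at q i) = 3")
      case True
      have "vc (put 0 14 20) Q (r'(24 := addr 0 (Suc i), 20 := end_at q i, 25 := 0)) m os (k' + 6)"
        using a b True by (intro fin) (auto simp: agree_def)
      then show ?thesis using True a(3-5) b ad r' e eM
        by (auto simp: end_children_def add.commute[of k'] intro!: vc_get)
    next
      case False
      let ?e = "end_at q (Suc i)"
      have b': "sym (sub_at q i) \<in> {1, 2}" "?e < n" "i < ?e" "end_at q ?e = end_at q i"
        using b(2) False by auto
      have e': "m (addr 0 ?e) = end_at q i" using m b' by simp
      have eM': "end_at q i < M" "addr 3 ?e < M"
        using end_at_le[OF r(3)] n_less_W state_less_M(3)[OF b'(2), of 0]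
        by (auto intro: small_less_M)
      have "vc (put 0 14 20) Q r'' m os k''"
        if "agree {20, 24, 25} r' r''" "r'' 20 = end_at q i" "k'' \<le> k' + 10" for r'' k''
        using a that by (intro fin) (auto simp: agree_def)
      then show ?thesis using False a(3-5) b b' ad r' e eM e' eM'
        by (auto simp: end_children_def agree_def intro!: vc_get)
    qed
  qed
  have less: "sym (sub_at q i) \<in> {1, 2, 3} \<Longrightarrow> Suc i < n"
    using Conc_less[OF r(3)] Alt_less[OF r(3)] Plus_less[OF r(3)] by (cases "sub_at q i") force+
  have test: "vc (If 25 Skip (If 18 end_children Skip)) (vc (put 0 14 20) Q) r' m os k'"
    if a: "agree {14, 18, 20, 25} r r'" "r' 14 = i" "r' 20 = Suc i" "r' 18 = sym (sub_at q i)"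
      "r' 25 = sym (sub_at q i) - 3" "k' \<le> k + 5" for r' k'
  proof -
    have leaf: "vc (put 0 14 20) Q r' m os k1" if "end_at q i = Suc i" "k1 \<le> k' + 3" for k1
      using a that by (intro fin) (auto simp: agree_def)
    have inner: "vc end_children (vc (put 0 14 20) Q) r' m os (k' + 1 + 1)"
      if "Suc i < n" "if sym (sub_at q i) = 3 then end_at q (Suc i) = end_at q i
        else sym (sub_at q i) \<in> {1, 2} \<and> end_at q (Suc i) < n \<and> i < end_at q (Suc i) \<and>
          end_at q (end_at q (Suc i)) = end_at q i"
      using a that by (intro children) auto
    show ?thesis
    proof (cases "sub_at q i")
      case Eps
      then show ?thesis using a leaf by (simp add: end_at_def)
    next
      case (Letter x)
      then show ?thesis using a leaf by (simp add: end_at_def)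
    next
      case (Conc x y)
      have "end_at q (Suc i) = i + 1 + rpq_length x" "end_at q (i + 1 + rpq_length x) = end_at q i"
        using node_at_Conc[OF r(3) Conc] Conc by (simp_all add: end_at_def sub_at_def)
      then show ?thesis using inner Conc_less[OF r(3) Conc] Conc a(4,5) by simp
    next
      case (Alt x y)
      have "end_at q (Suc i) = i + 1 + rpq_length x" "end_at q (i + 1 + rpq_length x) = end_at q i"
        using node_at_Alt[OF r(3) Alt] Alt by (simp_all add: end_at_def sub_at_def)
      then show ?thesis using inner Alt_less[OF r(3) Alt] Alt a(4,5) by simp
    next
      case (Plus x)
      have "end_at q (Suc i) = end_at q i"
        using node_at_Plus[OF r(3) Plus] Plus by (simp add: end_at_def sub_at_def)
      then show ?thesis using inner Plus_less[OF r(3) Plus] Plus a(4,5) by simp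
    qed
  qed
  show ?thesis unfolding end_node_def block.simps
    by (auto simp del: vc.simps(9) intro!: test)
qed

lemma vc_ends:
  assumes "const_regs r"
    and Q: "\<And>r' m' k'. const_regs r' \<Longrightarrow> (\<And>j. j < n \<Longrightarrow> m' (addr 0 j) = end_at q j) \<Longrightarrow>
      agree {14, 18, 20, 24, 25} r r' \<Longrightarrow> k' \<le> k + 21 * n + 2 \<Longrightarrow> Q r' m' os k'"
  shows "vc ends Q r m os k"
proof -
  define I where "I x r1 m1 os1 k1 \<longleftrightarrow> os1 = os \<and> r1 14 = x \<and> x \<le> n \<and>
    agree {14, 18, 20, 24, 25} r r1 \<and> (\<forall>j. x \<le> j \<and> j < n \<longrightarrow> m1 (addr 0 j) = end_at q j) \<and>
    k1 + 21 * x \<le> k + 21 * n + 1" for x r1 m1 os1 k1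
  have "vc (While 14 end_node) Q (r(14 := n)) m os (k + 1)"
  proof (rule vc_While[where I = I and x = n])
    show "I n (r(14 := n)) m os (k + 1)" by (auto simp: I_def)
  next
    fix x r1 m1 os1 k1
    assume I: "I x r1 m1 os1 k1" "r1 14 \<noteq> 0"
    then obtain i where i: "x = Suc i" by (cases x) (auto simp: I_def)
    have c: "const_regs r1" by (rule const_regs_agree[OF assms(1)]) (use I in \<open>auto simp: I_def\<close>)
    show "vc end_node (\<lambda>r m os k. \<exists>y < x. I y r m os k) r1 m1 os1 (k1 + 1)"
    proof (rule vc_end_node[OF c, of i])
      show "r1 14 = Suc i" "i < n" "\<And>j. i < j \<Longrightarrow> j < n \<Longrightarrow> m1 (addr 0 j) = end_at q j"
        using I i by (auto simp: I_def)
      fix r' k'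
      assume a: "agree {14, 18, 20, 24, 25} r1 r'" "r' 14 = i" "k' \<le> k1 + 1 + 20"
      have "agree {14, 18, 20, 24, 25} r r'" using a(1) I by (auto simp: I_def agree_def)
      then have "I i r' (m1(addr 0 i := end_at q i)) os1 k'"
        using I a(2,3) i by (auto simp: I_def)
      then show "\<exists>y < x. I y r' (m1(addr 0 i := end_at q i)) os1 k'" using i by blast
    qed
  next
    fix x r1 m1 os1 k1
    assume I: "I x r1 m1 os1 k1" "r1 14 = 0"
    have "const_regs r1" by (rule const_regs_agree[OF assms(1)]) (use I in \<open>auto simp: I_def\<close>)
    then show "Q r1 m1 os1 (k1 + 1)" using I Q[of r1 m1 "k1 + 1"] by (auto simp: I_def)
  qed
  moreover have "n < M" using n_less_W by (intro small_less_M) simp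
  ultimately show ?thesis using const_regsD[OF assms(1)] by (simp add: ends_def)
qed

definition kids :: "nat \<Rightarrow> nat set" where
  "kids i = (if sym (sub_at q i) \<in> {1, 2} then {i + 1, end_at q (i + 1)}
     else if sym (sub_at q i) = 3 then {i + 1} else {})"

definition linked :: "(nat \<Rightarrow> nat) \<Rightarrow> nat set \<Rightarrow> bool" where
  "linked m X \<longleftrightarrow> (\<forall>j < n. m (addr 0 j) = end_at q j) \<and> (\<forall>j \<in> X. m (addr 1 j) = cont_at q j)"

lemma linked_insert: "linked m X \<Longrightarrow> c = cont_at q j \<Longrightarrow> linked (m(addr 1 j := c)) (insert j X)"
  by (auto simp: linked_def)

lemma parent_kids: "0 < j \<Longrightarrow> j < n \<Longrightarrow> \<exists>p < j. j \<in> kids p"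
proof -
  assume j: "0 < j" "j < n"
  then show ?thesis
  proof (cases rule: parent_at)
    case (Binary p a b)
    then have p: "p < n" using j by simp
    have "end_at q (p + 1) = p + 1 + rpq_length a" "sym (sub_at q p) \<in> {1, 2}"
      using Binary(2) node_at_Conc(1)[OF p] node_at_Alt(1)[OF p]
      by (auto simp: end_at_def sub_at_def)
    then have "j \<in> kids p" using Binary(3) by (auto simp: kids_def)
    then show ?thesis using Binary(1) by blast
  next
    case (Unary p a)
    then have "j \<in> kids p" by (simp add: kids_def)
    then show ?thesis using Unary(1) by blast
  qed
qed

lemma vc_cont_children:
  assumes c: "const_regs r" and r: "r 20 = Suc i" "r 18 = sym (sub_at q i)" "r 27 = cont_at q i"
    and i: "i < n" "sym (sub_at q i) \<in> {1, 2, 3}" and m: "linked m X"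
    and Q: "\<And>r' m' k'. linked m' (X \<union> kids i) \<Longrightarrow> agree {21, 22, 24, 25} r r' \<Longrightarrow> k' \<le> k + 15 \<Longrightarrow>
      Q r' m' os k'"
  shows "vc cont_children Q r m os k"
proof -
  let ?e = "end_at q (Suc i)"
  have si: "Suc i < n"
    using i Conc_less Alt_less Plus_less by (cases "sub_at q i") force+
  have e: "m (addr 0 (Suc i)) = ?e" using m si by (simp add: linked_def)
  have M: "?e < M" "addr 3 (Suc i) < M" "n + Suc i < M" "addr 3 ?e < M" "0 < M" "1 < M" "Suc 0 < M" "2 < M"
    using end_at_le[OF si] si n_less_W W_ge_2 M_bound
    by (auto intro!: small_less_M simp: addr_def add_mult_distrib)
  note [simp] = const_regsD[OF c] r M e
  from i(2) consider "sym (sub_at q i) = 1" | "sym (sub_at q i) = 2" | "sym (sub_at q i) = 3" by auto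
  then show ?thesis
  proof cases
    case 1
    then obtain x y where s: "sub_at q i = Conc x y" by (cases "sub_at q i") auto
    have co: "cont_at q (Suc i) = ?e" "cont_at q ?e = cont_at q i"
      using node_at_Conc[OF i(1) s] by (simp_all add: cont_at_def end_at_def sub_at_def)
    have "linked (m(addr 1 (Suc i) := ?e, addr 1 ?e := cont_at q i)) (insert ?e (insert (Suc i) X))"
      using co m by (intro linked_insert) simp_all
    moreover have "X \<union> kids i = insert ?e (insert (Suc i) X)" using 1 by (auto simp: kids_def)
    ultimately have fin: "Q r' (m(addr 1 (Suc i) := ?e, addr 1 ?e := cont_at q i)) os k'"
      if "agree {21, 22, 24, 25} r r'" "k' \<le> k + 15" for r' k'
      using Q that by simp
    then show ?thesis using 1 unfolding cont_children_def block.simps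
      by (auto intro!: vc_get vc_put fin[unfolded One_nat_def])
  next
    case 2
    then obtain x y where s: "sub_at q i = Alt x y" by (cases "sub_at q i") auto
    have co: "cont_at q (Suc i) = cont_at q i" "cont_at q ?e = cont_at q i"
      using node_at_Alt[OF i(1) s] by (simp_all add: cont_at_def end_at_def sub_at_def)
    have "linked (m(addr 1 (Suc i) := cont_at q i, addr 1 ?e := cont_at q i))
      (insert ?e (insert (Suc i) X))"
      using co m by (intro linked_insert) simp_all
    moreover have "X \<union> kids i = insert ?e (insert (Suc i) X)" using 2 by (auto simp: kids_def)
    ultimately have fin: "Q r' (m(addr 1 (Suc i) := cont_at q i, addr 1 ?e := cont_at q i)) os k'"
      if "agree {21, 22, 24, 25} r r'" "k' \<le> k + 15" for r' k'
      using Q that by simp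
    then show ?thesis using 2 unfolding cont_children_def block.simps
      by (auto intro!: vc_get vc_put fin[unfolded One_nat_def])
  next
    case 3
    then obtain x where s: "sub_at q i = Plus x" by (cases "sub_at q i") auto
    have "cont_at q (Suc i) = n + Suc i"
      using node_at_Plus[OF i(1) s] by (simp add: cont_at_def)
    then have "linked (m(addr 1 (Suc i) := n + Suc i)) (insert (Suc i) X)"
      using m by (intro linked_insert) simp_all
    moreover have "X \<union> kids i = insert (Suc i) X" using 3 by (auto simp: kids_def)
    ultimately have fin: "Q r' (m(addr 1 (Suc i) := n + Suc i)) os k'"
      if "agree {21, 22, 24, 25} r r'" "k' \<le> k + 15" for r' k'
      using Q that by simp
    then show ?thesis using 3 M(3) unfolding cont_children_def block.simps
      by (auto intro!: vc_get vc_put fin[unfolded One_nat_def add_Suc_right])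
  qed
qed

text \<open>The positions whose continuation is known when position \<open>i\<close> is about to be
  processed. By \<open>parent_kids\<close>, \<open>i\<close> itself is among them.\<close>

definition linked_upto :: "nat \<Rightarrow> nat set" where
  "linked_upto i = insert 0 (\<Union>p<i. kids p)"

lemma vc_cont_node:
  assumes c: "const_regs r" and r: "r 14 = i" and i: "i < n" and m: "linked m (linked_upto i)"
    and Q: "\<And>r' m' k'. linked m' (linked_upto (Suc i)) \<Longrightarrow> agree ({14..27} - {23}) r r' \<Longrightarrow>
      r' 14 = Suc i \<Longrightarrow> r' 26 = n - Suc i \<Longrightarrow> k' \<le> k + 27 \<Longrightarrow> Q r' m' os k'"
  shows "vc cont_node Q r m os k"
proof -
  have up: "linked_upto (Suc i) = linked_upto i \<union> kids i"
    by (auto simp: linked_upto_def less_Suc_eq)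
  have "i \<in> linked_upto i" using parent_kids[of i] i by (cases "i = 0") (auto simp: linked_upto_def)
  then have ci: "m (addr 1 i) = cont_at q i" "m (addr (Suc 0) i) = cont_at q i"
    using m by (auto simp: linked_def)
  note [simp] = const_regsD[OF c] r read_symbol[OF i] state_less_M[OF i cont_at_le[OF i]] ci i
  have nM: "n - j < M" for j using n_less_W by (intro small_less_M) simp
  have fin: "vc cont_next Q r' m' os k'"
    if a: "agree {18, 20, 21, 22, 24, 25, 27} r r'" "linked m' (linked_upto (Suc i))" "k' \<le> k + 25"
    for r' m' k'
  proof -
    have "r' 14 = i" "r' 1 = 1" "r' (Suc 0) = 1" "r' 5 = n" using a(1) by (simp_all add: agree_def)
    moreover have "Q (r'(14 := Suc i, 26 := n - Suc i)) m' os (k' + 2)"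
      using a by (intro Q) (auto simp: agree_def)
    ultimately show ?thesis using nM by (simp add: cont_next_def)
  qed
  have test: "vc (If 25 Skip (If 18 cont_children Skip))
      (vc cont_next Q) r' m os k'"
    if a: "agree {18, 20, 24, 25, 27} r r'" "r' 20 = Suc i" "r' 18 = sym (sub_at q i)"
      "r' 25 = sym (sub_at q i) - 3" "r' 27 = cont_at q i" "k' \<le> k + 7" for r' k'
  proof (cases "sym (sub_at q i) \<in> {1, 2, 3}")
    case True
    have c': "const_regs r'" by (rule const_regs_agree[OF c a(1)]) auto
    have "vc cont_children (vc cont_next Q) r' m os (k' + 1 + 1)"
    proof (rule vc_cont_children[OF c' a(2,3,5) i True m])
      fix r'' m' k''
      assume b: "linked m' (linked_upto i \<union> kids i)" "agree {21, 22, 24, 25} r' r''" "k'' \<le> k' + 1 + 1 + 15"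
      show "vc cont_next Q r'' m' os k''"
        using a b up by (intro fin) (auto simp: agree_def)
    qed
    then show ?thesis using True a(3,4) by auto
  next
    case False
    have "linked m (linked_upto (Suc i))" using m False up by (auto simp: kids_def)
    then have "vc cont_next Q r' m os k1"
      if "k1 \<le> k' + 3" for k1
      using a that by (intro fin) (auto simp: agree_def)
    then show ?thesis using a(3,4) False by simp
  qed
  show ?thesis unfolding cont_node_def block.simps
    by (auto simp del: vc.simps(9) intro!: vc_get test)
qed

lemma vc_conts:
  assumes c: "const_regs r" and m: "\<And>j. j < n \<Longrightarrow> m (addr 0 j) = end_at q j"
    and Q: "\<And>r' m' k'. tables m' \<Longrightarrow> agree ({14..27} - {23}) r r' \<Longrightarrow> k' \<le> k + 28 * n + 6 \<Longrightarrow> Q r' m' os k'"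
  shows "vc conts Q r m os k"
proof -
  define I where "I x r1 m1 os1 k1 \<longleftrightarrow> os1 = os \<and> (\<exists>i \<le> n. r1 14 = i \<and> r1 26 = n - i \<and> x = n - i \<and>
    linked m1 (linked_upto i) \<and> agree ({14..27} - {23}) r r1 \<and> k1 \<le> k + 28 * i + 5)" for x r1 m1 os1 k1
  have loop: "vc (While 26 cont_node) Q r1 m1 os1 k1" if "I n r1 m1 os1 k1" for r1 m1 os1 k1
  proof (rule vc_While[where I = I, OF that])
    fix x r1 m1 os1 k1
    assume I: "I x r1 m1 os1 k1" "r1 26 \<noteq> 0"
    then obtain i where i: "os1 = os" "i < n" "r1 14 = i" "x = n - i" "linked m1 (linked_upto i)"
      "agree ({14..27} - {23}) r r1" "k1 \<le> k + 28 * i + 5"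
      unfolding I_def by auto
    have c1: "const_regs r1" by (rule const_regs_agree[OF c i(6)]) auto
    show "vc cont_node (\<lambda>r m os k. \<exists>y < x. I y r m os k) r1 m1 os1 (k1 + 1)"
    proof (rule vc_cont_node[OF c1 i(3,2,5)])
      fix r' m' k'
      assume a: "linked m' (linked_upto (Suc i))" "agree ({14..27} - {23}) r1 r'"
        "r' 14 = Suc i" "r' 26 = n - Suc i" "k' \<le> k1 + 1 + 27"
      have "I (n - Suc i) r' m' os1 k'" unfolding I_def
        using a i agree_trans[OF i(6) a(2)] by (intro conjI exI[of _ "Suc i"]) auto
      then show "\<exists>y < x. I y r' m' os1 k'" using i by (intro exI[of _ "n - Suc i"]) auto
    qed
  next
    fix x r1 m1 os1 k1
    assume I: "I x r1 m1 os1 k1" "r1 26 = 0"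
    then have i: "os1 = os" "linked m1 (linked_upto n)"
      "agree ({14..27} - {23}) r r1" "k1 \<le> k + 28 * n + 5"
      unfolding I_def by auto
    have "j \<in> linked_upto n" if "j < n" for j
      using parent_kids[of j] that by (cases "j = 0") (auto simp: linked_upto_def)
    then have "tables m1" using i(2) by (auto simp: tables_def linked_def)
    then show "Q r1 m1 os1 (k1 + 1)" using Q i by simp
  qed
  have nM: "n < M" "addr 3 0 < M" "0 < M" using n_less_W W_ge_2 by (auto intro!: small_less_M simp: addr_def)
  have l: "linked (m(addr 1 0 := n)) (linked_upto 0)"
    using m by (auto simp: linked_def linked_upto_def sub_at_0)
  have "vc (While 26 cont_node) Q r1 (m(addr 1 0 := n)) os k1"
    if "agree {14, 24, 26} r r1" "r1 14 = 0" "r1 26 = n" "k1 \<le> k + 5" for r1 k1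
    by (rule loop) (use that l in \<open>auto simp: I_def agree_def\<close>)
  note loop' = this[unfolded vc.simps(10) One_nat_def]
  show ?thesis unfolding conts_def block.simps
    using const_regsD[OF c] nM by (auto intro!: vc_put loop')
qed

end

section \<open>The enumeration\<close>

text \<open>Register \<open>13\<close> has two roles: after a search it tells whether there are
  answers to list, and before the next one whether the marks must be cleared. They coincide, since
  marks lose their value exactly when the search met a final state.\<close>

definition round :: com where
  "round = block [If 13 (block [clear, Arith Add 13 0 0]) Skip, Read 12 11, dfs, If 13 scan Skip,
     advance 11]"

text \<open>The flag starts nonzero because earlier enumerations may have left arbitrary marks in
  the work memory.\<close>

definition enum_all :: com where
  "enum_all = block [ends, conts, Arith Add 13 1 0, While 11 round]"

definition enum_com :: "nat \<Rightarrow> com" where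
  "enum_com sigma = block [init sigma, Read 11 1, If 11 enum_all Skip]"

context enum_run
begin

abbreviation "len \<equiv> length (node_list R)"

definition clear_cost :: nat where
  "clear_cost = (6 * width + 7) * len + 2"

text \<open>Per node, \<open>40\<close> is the credit for rounds and \<open>11\<close> covers the
  scan that follows an output. Per position, \<open>21\<close> and \<open>28\<close> pay for the two
  table passes.\<close>

definition setup_cost :: nat where
  "setup_cost = 51 * len + 49 * n + 40"

definition answers :: "nat \<Rightarrow> (nat \<times> nat) list" where
  "answers u = map (Pair u) (filter (\<lambda>v. (v, n) \<in> reach u) (node_list R))"

text \<open>
  Each remaining node is credited with \<open>40\<close> time units for the constant work of its round. The
  time that passes since the last output in searches without answers is paid by the costs of the
  states in \<open>Dead\<close>.
\<close>

lemma vc_round: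
  assumes B: "setup_cost + clear_cost + sum cost P + 11 * len + 50 \<le> B"
    and c: "const_regs r" "tables m" "list_at inp (r 11) (u # us)" "u \<in> V" "r 11 < W"
    and us: "length us < len"
    and found: "r 13 \<noteq> 0 \<Longrightarrow> k + 39 + 40 * length us \<le> setup_cost"
    and dead: "r 13 = 0 \<Longrightarrow> marks m Dead \<and> Dead \<subseteq> P \<and> (\<forall>x \<in> Dead. set (psucc R q x) \<subseteq> Dead) \<and>
      (\<forall>v. (v, n) \<notin> Dead) \<and> k + 39 + 40 * length us \<le> setup_cost + clear_cost + sum cost Dead"
    and Q: "\<And>r' m' k' Dead'. const_regs r' \<Longrightarrow> tables m' \<Longrightarrow> list_at inp (r' 11) us \<Longrightarrow> r' 11 < W \<Longrightarrow>
      (r' 13 \<noteq> 0 \<Longrightarrow> k' + 40 * length us \<le> setup_cost) \<Longrightarrow>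
      (r' 13 = 0 \<Longrightarrow> marks m' Dead' \<and> Dead' \<subseteq> P \<and> (\<forall>x \<in> Dead'. set (psucc R q x) \<subseteq> Dead') \<and>
        (\<forall>v. (v, n) \<notin> Dead') \<and>
        k' + 40 * length us \<le> setup_cost + clear_cost + sum cost Dead') \<Longrightarrow>
      Q r' m' (os @ answers u) k'"
  shows "vc round Q r m os k"
proof -
  have p: "r 11 \<noteq> 0" using c(3) list_at_0 by (metis list.distinct(1))
  then have u: "inp (r 11) = u" "list_at inp (inp (r 11 + 1)) us"
    using c(3) list_at_nonzero by auto
  have M: "Suc (r 11) < M" "0 < M" "u < M"
    using c(5) W_ge_2 node_less_W[OF c(4)] by (auto intro!: small_less_M)
  have next_node: "vc (advance 11) Q r1 m1 (os @ answers u) k1"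
    if a: "const_regs r1" "tables m1" "r1 11 = r 11"
      "r1 13 \<noteq> 0 \<Longrightarrow> k1 + 2 + 40 * length us \<le> setup_cost"
      "r1 13 = 0 \<Longrightarrow> marks m1 Dead' \<and> Dead' \<subseteq> P \<and> (\<forall>x \<in> Dead'. set (psucc R q x) \<subseteq> Dead') \<and>
        (\<forall>v. (v, n) \<notin> Dead') \<and>
        k1 + 2 + 40 * length us \<le> setup_cost + clear_cost + sum cost Dead'"
    for r1 m1 k1 Dead'
  proof -
    have "Q (r1(25 := Suc (r 11), 11 := inp (Suc (r 11)))) m1 (os @ answers u) (k1 + 2)"
      using a u(2) inp_less_W by (intro Q[where Dead' = Dead']) auto
    then show ?thesis unfolding advance_def using const_regsD[OF a(1)] a(3) M by simp
  qed
  have search: "vc (Read 12 11) (vc dfs (vc (If 13 scan Skip) (vc (advance 11) Q))) r1 m1 os k1"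
    if a: "const_regs r1" "tables m1" "r1 11 = r 11" "r1 13 = 0" "marks m1 Dead" "Dead \<subseteq> P"
      "\<forall>x \<in> Dead. set (psucc R q x) \<subseteq> Dead" "\<forall>v. (v, n) \<notin> Dead"
      "k1 + 34 + 40 * length us \<le> setup_cost + clear_cost + sum cost Dead"
    for r1 m1 k1 Dead
  proof -
    have "vc dfs (vc (If 13 scan Skip) (vc (advance 11) Q)) (r1(12 := u)) m1 os (k1 + 1)"
    proof (rule vc_dfs[where Dead = Dead and u = u])
      fix r' m' k'
      let ?D = "Dead \<union> reach u"
      assume b: "const_regs r'" "tables m'" "marks m' ?D"
        "(r' 13 \<noteq> 0) = (\<exists>v. (v, n) \<in> reach u)" "agree ({13..27} - {23}) (r1(12 := u)) r'"
        "k' + sum cost Dead \<le> k1 + 1 + 20 + sum cost ?D"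
      have r': "r' 11 = r 11" "r' 12 = u"
        using agreeD[OF b(5), of 11] agreeD[OF b(5), of 12] a(3) by simp_all
      have DP: "?D \<subseteq> P" using a(6) reach_P[OF c(4)] by simp
      have k': "k' + 13 + 40 * length us \<le> setup_cost + clear_cost + sum cost ?D"
        using b(6) a(9) by linarith
      show "vc (If 13 scan Skip) (vc (advance 11) Q) r' m' os k'"
      proof (cases "r' 13 = 0")
        case True
        have no: "\<forall>v. (v, n) \<notin> reach u" using b(4) True by simp
        then have "answers u = []" by (simp add: answers_def)
        moreover have "vc (advance 11) Q r' m' (os @ answers u) (k' + 1 + 1)"
        proof (rule next_node[OF b(1,2) r'(1)])
          have "\<forall>x \<in> ?D. set (psucc R q x) \<subseteq> ?D" using a(7) reach_step by blast
          then show "marks m' ?D \<and> ?D \<subseteq> P \<and> (\<forall>x \<in> ?D. set (psucc R q x) \<subseteq> ?D) \<and>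
            (\<forall>v. (v, n) \<notin> ?D) \<and>
            k' + 1 + 1 + 2 + 40 * length us \<le> setup_cost + clear_cost + sum cost ?D"
            using b(3) DP a(8) no k' by simp
        qed (use True in simp)
        ultimately show ?thesis using True by simp
      next
        case False
        then obtain v where v: "(v, n) \<in> reach u" using b(4) by blast
        then have vV: "v \<in> V" using reach_P[OF c(4)] by (auto simp: pstates_def)
        have sumD: "sum cost ?D \<le> sum cost P" by (rule sum_mono2[OF finite_P DP]) simp
        \<comment> \<open>The scan sees all marks, including inherited ones, but no dead state is
          final.\<close>
        have fl: "filter (\<lambda>v. (v, n) \<in> ?D) (node_list R) = filter (\<lambda>v. (v, n) \<in> reach u) (node_list R)"
          using a(8) by (intro filter_cong) auto
        have "vc scan (vc (advance 11) Q) r' m' os (k' + 1)"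
        proof (rule vc_scan[OF b(1,3) r'(2)])
          show "k' + 1 + 11 * len + 1 \<le> B" "11 \<le> B" using k' sumD B by linarith+
          show "\<exists>v \<in> V. (v, n) \<in> ?D" using v vV by blast
          fix r'' k''
          assume d: "agree ({14..27} - {23}) r' r''" "k'' \<le> 11 * len + 1"
          have c'': "const_regs r''" by (rule const_regs_agree[OF b(1) d(1)]) auto
          have r'': "r'' 11 = r 11" "r'' 13 = r' 13"
            using agreeD[OF d(1), of 11] agreeD[OF d(1), of 13] r' by simp_all
          have "vc (advance 11) Q r'' m' (os @ answers u) k''"
          \<comment> \<open>The flag is still raised, so the condition on \<open>Dead'\<close> is
            vacuous and any witness serves.\<close>
          proof (rule next_node[OF c'' b(2) r''(1), where Dead' = "{}"])
            show "k'' + 2 + 40 * length us \<le> setup_cost"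
              using d(2) us unfolding setup_cost_def by linarith
          qed (use False r'' in simp)
          then show "vc (advance 11) Q r'' m'
              (os @ map (Pair u) (filter (\<lambda>v. (v, n) \<in> ?D) (node_list R))) k''"
            unfolding fl answers_def .
        qed
        then show ?thesis using False by simp
      qed
    qed (use a c(4) in simp_all)
    then show ?thesis using a(3) u(1) M by simp
  qed
  have "vc (If 13 (block [clear, Arith Add 13 0 0]) Skip)
    (vc (Read 12 11) (vc dfs (vc (If 13 scan Skip) (vc (advance 11) Q)))) r m os k"
  proof (cases "r 13 = 0")
    case True
    then have "vc (Read 12 11) (vc dfs (vc (If 13 scan Skip) (vc (advance 11) Q))) r m os (k + 1 + 1)"
      using dead c by (intro search[where Dead = Dead]) auto
    then show ?thesis using True by (simp del: vc.simps(4))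
  next
    case False
    have "vc clear (vc (Arith Add 13 0 0) (vc (Read 12 11)
      (vc dfs (vc (If 13 scan Skip) (vc (advance 11) Q))))) r m os (k + 1)"
    proof (rule vc_clear[OF c(1,2)])
      fix r' m'
      assume a: "tables m'" "marks m' {}" "agree ({14..27} - {23}) r r'"
      have c': "const_regs r'" by (rule const_regs_agree[OF c(1) a(3)]) auto
      have "vc (Read 12 11) (vc dfs (vc (If 13 scan Skip) (vc (advance 11) Q))) (r'(13 := 0)) m' os
        (k + 1 + (6 * width + 7) * len + 2 + 1)"
        using a c' found[OF False] agreeD[OF a(3), of 11]
        by (intro search[where Dead = "{}"]) (auto simp: clear_cost_def)
      then show "vc (Arith Add 13 0 0) (vc (Read 12 11)
          (vc dfs (vc (If 13 scan Skip) (vc (advance 11) Q)))) r' m' os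
          (k + 1 + (6 * width + 7) * len + 2)"
        using const_regsD[OF c'] M by (simp del: vc.simps(4))
    qed
    then show ?thesis using False by (simp del: vc.simps(3,4))
  qed
  then show ?thesis unfolding round_def block.simps by simp
qed

lemma vc_rounds:
  assumes B: "setup_cost + clear_cost + sum cost P + 11 * len + 50 \<le> B"
    and "const_regs r" "tables m" "list_at inp (r 11) us" "set us \<subseteq> V" "r 11 < W"
    and "length us \<le> len"
    and "r 13 \<noteq> 0 \<Longrightarrow> k + 40 * length us \<le> setup_cost"
    and "r 13 = 0 \<Longrightarrow> marks m Dead \<and> Dead \<subseteq> P \<and> (\<forall>x \<in> Dead. set (psucc R q x) \<subseteq> Dead) \<and>
      (\<forall>v. (v, n) \<notin> Dead) \<and> k + 40 * length us \<le> setup_cost + clear_cost + sum cost Dead"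
    and Q: "\<And>r' m' k'. k' \<le> B \<Longrightarrow> Q r' m' (os @ concat (map answers us)) k'"
  shows "vc (While 11 round) Q r m os k"
  using assms(2-)
proof (induction us arbitrary: r m os k Dead)
  case Nil
  then have "r 11 = 0" using list_at_nonzero by fastforce
  moreover have "k + 1 \<le> B"
  proof (cases "r 13 = 0")
    case True
    then have D: "Dead \<subseteq> P" "k \<le> setup_cost + clear_cost + sum cost Dead" using Nil.prems(8) by auto
    have "sum cost Dead \<le> sum cost P" by (rule sum_mono2[OF finite_P D(1)]) simp
    then show ?thesis using D(2) B by linarith
  next
    case False
    then show ?thesis using Nil.prems(7) B by simp
  qed
  then have "Q r m os (k + 1)" using Nil.prems(9)[of "k + 1" r m] by simp
  ultimately show ?case by (auto intro: wp_While_False)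
next
  case (Cons u us)
  have p: "r 11 \<noteq> 0" using Cons.prems(3) list_at_0 by (metis list.distinct(1))
  have "vc round (vc (While 11 round) Q) r m os (k + 1)"
  proof (rule vc_round[OF B Cons.prems(1,2,3), where Dead = Dead])
    show "u \<in> V" "length us < len" "r 11 < W" using Cons.prems by auto
    show "r 13 \<noteq> 0 \<Longrightarrow> k + 1 + 39 + 40 * length us \<le> setup_cost" using Cons.prems(7) by simp
    show "r 13 = 0 \<Longrightarrow> marks m Dead \<and> Dead \<subseteq> P \<and> (\<forall>x \<in> Dead. set (psucc R q x) \<subseteq> Dead) \<and>
      (\<forall>v. (v, n) \<notin> Dead) \<and> k + 1 + 39 + 40 * length us \<le> setup_cost + clear_cost + sum cost Dead"
      using Cons.prems(8) by simp
    fix r' m' k' Dead'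
    assume a: "const_regs r'" "tables m'" "list_at inp (r' 11) us" "r' 11 < W"
      "r' 13 \<noteq> 0 \<Longrightarrow> k' + 40 * length us \<le> setup_cost"
      "r' 13 = 0 \<Longrightarrow> marks m' Dead' \<and> Dead' \<subseteq> P \<and> (\<forall>x \<in> Dead'. set (psucc R q x) \<subseteq> Dead') \<and>
        (\<forall>v. (v, n) \<notin> Dead') \<and>
        k' + 40 * length us \<le> setup_cost + clear_cost + sum cost Dead'"
    show "vc (While 11 round) Q r' m' (os @ answers u) k'"
    proof (rule Cons.IH[OF a(1-3) _ a(4) _ a(5,6)])
      show "set us \<subseteq> V" "length us \<le> len" using Cons.prems by auto
      fix r'' m'' k''
      assume "k'' \<le> B"
      then show "Q r'' m'' ((os @ answers u) @ concat (map answers us)) k''"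
        using Cons.prems(9) by simp
    qed
  qed
  then show ?case using p by (simp add: wp_While_True vc_imp_wp)
qed

lemma vc_enum:
  assumes B: "node_list R \<noteq> [] \<Longrightarrow> setup_cost + clear_cost + sum cost P + 11 * len + 50 \<le> B" "14 \<le> B"
    and Q: "\<And>r' m' k'. k' \<le> B \<Longrightarrow> Q r' m' (concat (map answers (node_list R))) k'"
  shows "vc (enum_com sigma) Q r m [] 0"
proof -
  have main: "vc (If 11 enum_all Skip) Q (r'(11 := inp 1)) m [] 12" if c: "const_regs r'" for r'
  proof (cases "inp 1 = 0")
    case True
    then have "node_list R = []" using list_at_nodes list_at_0 by simp
    then show ?thesis using True B(2) Q[of 14] by simp
  next
    case False
    have c': "const_regs (r'(11 := inp 1))" using c by simp
    have ne: "node_list R \<noteq> []" using list_at_nodes unfolding list_at_nonzero[OF False] by auto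
    have "vc ends (vc conts (vc (Arith Add 13 1 0) (vc (While 11 round) Q))) (r'(11 := inp 1)) m [] 13"
    proof (rule vc_ends[OF c'])
      fix r1 m1 k1
      assume a: "const_regs r1" "\<And>j. j < n \<Longrightarrow> m1 (addr 0 j) = end_at q j"
        "agree {14, 18, 20, 24, 25} (r'(11 := inp 1)) r1" "k1 \<le> 13 + 21 * n + 2"
      show "vc conts (vc (Arith Add 13 1 0) (vc (While 11 round) Q)) r1 m1 [] k1"
      proof (rule vc_conts[OF a(1,2)])
        fix r2 m2 k2
        assume b: "tables m2" "agree ({14..27} - {23}) r1 r2" "k2 \<le> k1 + 28 * n + 6"
        have c2: "const_regs r2" by (rule const_regs_agree[OF a(1) b(2)]) auto
        have r2: "r2 11 = inp 1" using agreeD[OF b(2), of 11] agreeD[OF a(3), of 11] by simp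
        have "vc (While 11 round) Q (r2(13 := 1)) m2 [] (k2 + 1)"
        proof (rule vc_rounds[OF B(1)[OF ne], where us = "node_list R" and Dead = "{}"])
          show "list_at inp ((r2(13 := 1)) 11) (node_list R)" using r2 list_at_nodes by simp
          show "(r2(13 := 1)) 11 < W" using r2 inp_less_W by simp
          show "k2 + 1 + 40 * len \<le> setup_cost" using a(4) b(3) by (simp add: setup_cost_def)
          show "const_regs (r2(13 := 1))" "tables m2" using c2 b(1) by simp_all
          fix r' m' k'
          assume "k' \<le> B"
          then show "Q r' m' ([] @ concat (map answers (node_list R))) k'" unfolding append_Nil by (rule Q)
        qed simp_all
        moreover have "1 < M" using W_ge_2 by (intro small_less_M) simp
        ultimately show "vc (Arith Add 13 1 0) (vc (While 11 round) Q) r2 m2 [] k2"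
          using const_regsD[OF c2] by simp
      qed
    qed
    then show ?thesis using False by (simp add: enum_all_def)
  qed
  have body: "vc (Read 11 1) (vc (If 11 enum_all Skip) Q) r' m [] (0 + 11)" if "const_regs r'" for r'
  proof -
    have "r' 1 = 1" using const_regsD[OF that] by simp
    moreover have "inp 1 < M" by simp
    ultimately show ?thesis using main[OF that] by (simp del: vc.simps(9))
  qed
  have "vc (init sigma) (vc (Read 11 1) (vc (If 11 enum_all Skip) Q)) r m [] 0"
    by (rule vc_init) (rule body)
  then show ?thesis unfolding enum_com_def block.simps vc.simps(8) .
qed

section \<open>Total cost and correctness of the output\<close>

lemma sum_length_succ:
  assumes "x < sigma"
  shows "(\<Sum>u \<in> V. length (succ_list R u x)) \<le> card (arcs D)"
proof -
  have V: "distinct (succ_list R u x)" "set (succ_list R u x) \<subseteq> V" if "u \<in> V" for u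
    using valid assms that by (auto simp: valid_rep_def)
  have "arcs D \<subseteq> V \<times> {..<sigma} \<times> V" using valid by (auto simp: db_of_def valid_rep_def)
  then have fin: "finite (arcs D)" by (rule finite_subset) simp
  have "(\<Sum>u \<in> V. length (succ_list R u x)) = (\<Sum>u \<in> V. card (set (succ_list R u x)))"
    using V by (intro sum.cong) (simp_all add: distinct_card)
  also have "\<dots> = card (SIGMA u:V. set (succ_list R u x))" by simp
  also have "\<dots> = card ((\<lambda>(u, v). (u, x, v)) ` (SIGMA u:V. set (succ_list R u x)))"
    by (rule card_image[symmetric]) (auto simp: inj_on_def)
  also have "\<dots> \<le> card (arcs D)"
    by (rule card_mono[OF fin]) (use assms in \<open>auto simp: db_of_def\<close>)
  finally show ?thesis .
qed

lemma length_psucc: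
  "length (psucc R q (u, s)) \<le> 2 +
     (if s < n then case sub_at q s of Letter x \<Rightarrow> length (succ_list R u x) | _ \<Rightarrow> 0 else 0)"
  by (auto simp: psucc_def Let_def split: rpq.split)

text \<open>For a fixed letter position, the successor lists of all nodes together contain at most
  every arc once, and there are at most \<open>n\<close> such positions. Every other edge count is
  at most \<open>2\<close>, and \<open>105\<close> is \<open>71 + 2 * 17\<close>.\<close>

lemma sum_cost_le: "sum cost P \<le> 105 * (len * (2 * n + 1)) + 17 * (n * card (arcs D))"
proof -
  define f where "f s u = (case sub_at q s of Letter x \<Rightarrow> length (succ_list R u x) | _ \<Rightarrow> 0)" for s u
  have cV: "card V = len" using valid by (simp add: valid_rep_def distinct_card)
  have cP: "card P = len * (2 * n + 1)" by (simp add: pstates_def card_cartesian_product cV)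
  have f: "(\<Sum>u \<in> V. f s u) \<le> card (arcs D)" if "s < n" for s
    using sum_length_succ letter_less[OF that] by (cases "sub_at q s") (auto simp: f_def)
  have "cost (u, s) \<le> 105 + 17 * (if s < n then f s u else 0)" for u s
    using length_psucc[of u s] by (simp add: cost_def f_def split: if_splits)
  then have "sum cost P \<le> (\<Sum>(u, s) \<in> P. 105 + 17 * (if s < n then f s u else 0))"
    by (intro sum_mono) auto
  also have "\<dots> = 105 * card P + 17 * (\<Sum>(u, s) \<in> P. if s < n then f s u else 0)"
    by (simp add: sum.distrib split_beta sum_distrib_left)
  also have "(\<Sum>(u, s) \<in> P. if s < n then f s u else 0) =
      (\<Sum>s \<le> 2 * n. \<Sum>u \<in> V. if s < n then f s u else 0)"
    unfolding pstates_def by (subst sum.swap) (simp add: sum.cartesian_product)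
  also have "\<dots> = (\<Sum>s \<le> 2 * n. if s < n then \<Sum>u \<in> V. f s u else 0)"
    by (intro sum.cong) auto
  also have "\<dots> = (\<Sum>s \<in> {..<n}. \<Sum>u \<in> V. f s u)"
    by (rule sum.mono_neutral_cong_right) auto
  also have "\<dots> \<le> (\<Sum>s \<in> {..<n}. card (arcs D))" by (intro sum_mono f) simp
  also have "\<dots> = n * card (arcs D)" by simp
  finally show ?thesis unfolding cP by simp
qed

text \<open>With at least one node, \<open>len\<close>, \<open>n\<close> and the constants are
  absorbed by \<open>len * n\<close>. The coefficients then add up to \<open>566\<close>, so
  \<open>1000\<close> leaves slack.\<close>

lemma total_cost:
  assumes "node_list R \<noteq> []"
  shows "setup_cost + clear_cost + sum cost P + 11 * len + 50 \<le> 1000 * (db_size D * n)"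
proof -
  have cV: "card (verts D) = len" using valid by (simp add: db_of_def valid_rep_def distinct_card)
  have L: "1 \<le> len" "1 \<le> n" using assms rpq_length_pos[of q] by (simp_all add: Suc_le_eq)
  have 1: "len \<le> db_size D" "card (arcs D) \<le> db_size D" using cV by (simp_all add: db_size_def)
  then have 2: "len * n \<le> db_size D * n" "n * card (arcs D) \<le> db_size D * n"
    by (simp_all add: mult.commute)
  have 3: "len \<le> len * n" "n \<le> len * n" "1 \<le> len * n" using L by simp_all
  have "clear_cost = 12 * (len * n) + 19 * len + 2"
    by (simp add: clear_cost_def width_def algebra_simps)
  moreover have "105 * (len * (2 * n + 1)) = 210 * (len * n) + 105 * len" by (simp add: algebra_simps)
  ultimately show ?thesis using sum_cost_le 2 3 unfolding setup_cost_def by linarith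
qed

text \<open>Adding \<open>x \<noteq> y\<close> to the order lets a single \<open>sorted_wrt\<close>
  deliver both sortedness and distinctness.\<close>

lemma answers_sorted:
  "lists_sorted sigma q R tr" if "outputs tr = concat (map answers (node_list R))"
proof -
  let ?lt = "\<lambda>u v. u \<noteq> v \<and> node_le R u v"
  have ns: "sorted_wrt ?lt (node_list R)"
    unfolding sorted_wrt_iff_nth_less
  proof (intro allI impI)
    fix i j assume ij: "i < j" "j < length (node_list R)"
    then have "node_list R ! i \<noteq> node_list R ! j"
      using valid by (simp add: valid_rep_def nth_eq_iff_index_eq)
    moreover have "node_le R (node_list R ! i) (node_list R ! j)"
      unfolding node_le_def using ij less_imp_le by blast
    ultimately show "?lt (node_list R ! i) (node_list R ! j)" ..
  qed
  have "sorted_wrt (\<lambda>x y. x \<noteq> y \<and> pair_le R x y) (concat (map answers us))" if "sorted_wrt ?lt us" for us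
    using that
  proof (induction us)
    case (Cons u us)
    have "sorted_wrt (\<lambda>x y. x \<noteq> y \<and> pair_le R x y) (answers u)"
      unfolding answers_def sorted_wrt_map
      by (rule sorted_wrt_filter, rule sorted_wrt_mono_rel[OF _ ns]) (auto simp: pair_le_def)
    then show ?case using Cons by (auto simp: sorted_wrt_append answers_def pair_le_def)
  qed simp
  then have s: "sorted_wrt (\<lambda>x y. x \<noteq> y \<and> pair_le R x y) (outputs tr)"
    unfolding that using ns by blast
  have "rpq_result q D \<subseteq> V \<times> V" by (auto simp: rpq_result_def db_of_def)
  moreover have "set (outputs tr) = {(u, v). u \<in> V \<and> v \<in> V \<and> (v, n) \<in> reach u}"
    unfolding that by (auto simp: answers_def)
  ultimately have set: "set (outputs tr) = rpq_result q D"
    using reach_iff by (auto simp: reach_def)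
  have "distinct xs" if "sorted_wrt (\<lambda>x y. x \<noteq> y \<and> pair_le R x y) xs" for xs
    using that by (induction xs) auto
  then have "distinct (outputs tr)" using s by blast
  moreover have "sorted_wrt (pair_le R) (outputs tr)" by (rule sorted_wrt_mono_rel[OF _ s]) simp
  moreover note set
  ultimately show ?thesis by (simp add: lists_sorted_def)
qed

text \<open>The state \<open>s\<close> is arbitrary: the program initialises every register and cell
  on which it relies. The factor \<open>max 1\<close> provides for the empty database.\<close>

lemma enumeration:
  assumes "B = 1000 * max 1 (db_size D * n)"
  shows "\<exists>tr s'. exec wl inp (enum_com sigma) s tr s' \<and> lists_sorted sigma q R tr \<and> delay tr \<le> B"
proof -
  have B: "setup_cost + clear_cost + sum cost P + 11 * len + 50 \<le> B"
    if "node_list R \<noteq> []" using total_cost[OF that] assms by simp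
  let ?Q = "\<lambda>r m os k. os = concat (map answers (node_list R)) \<and> k \<le> B"
  have "vc (enum_com sigma) ?Q (reg s) (mem s) [] 0"
    by (rule vc_enum[OF B]) (use assms in auto)
  then have "wp (enum_com sigma) ?Q (reg s) (mem s) [] 0" by (rule vc_imp_wp)
  then obtain tr s' where "exec wl inp (enum_com sigma) s tr s'" "paced B 0 tr"
    "outputs tr = concat (map answers (node_list R))" "elapsed 0 tr \<le> B"
    unfolding wp_def by auto
  then show ?thesis using answers_sorted max_gap_le unfolding delay_def by blast
qed

end

text \<open>Since the enumeration works from any machine state, this is all that is needed about the
  history of updates and earlier enumerations.\<close>

lemma reachable_stores:
  "reachable sigma wl w A q R inp s \<Longrightarrow> valid_rep sigma R \<and> stores sigma w inp R q"
  by (induction rule: reachable.induct) (auto simp: updates_to_def)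

theorem theorem6p1:
  fixes sigma :: nat
  shows "\<exists>A k c. solves_sorted_enum sigma k A
           (\<lambda>D q. c * max 1 (db_size D * rpq_length q))
           (\<lambda>D q. c)"
proof (intro exI)
  let ?A = "\<lparr>preprocess = Skip, enumerate = enum_com sigma, update_routine = Skip\<rparr>"
  show "solves_sorted_enum sigma (sigma + 9) ?A
    (\<lambda>D q. 1000 * max 1 (db_size D * rpq_length q)) (\<lambda>D q. 1000)"
    unfolding solves_sorted_enum_def
  proof (intro allI impI conjI)
    fix w q R inp
    show "\<exists>tr s. exec ((sigma + 9) * w) inp (preprocess ?A) initial_state tr s \<and> outputs tr = [] \<and>
      length tr \<le> 1000 * max 1 (db_size (db_of sigma R) * rpq_length q)"
      by (intro exI[of _ "[Tick]"] exI conjI) (simp, rule exec_Skip, auto)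
  next
    fix w q R inp s
    assume q: "set_rpq q \<subseteq> {..<sigma}"
      and r: "reachable sigma ((sigma + 9) * w) w ?A q R inp s"
    interpret enum_run sigma R q "(sigma + 9) * w" inp
      "1000 * max 1 (db_size (db_of sigma R) * rpq_length q)" w
      by unfold_locales (use q reachable_stores[OF r] in simp_all)
    show "\<exists>tr s'. exec ((sigma + 9) * w) inp (enumerate ?A) s tr s' \<and> lists_sorted sigma q R tr \<and>
      delay tr \<le> 1000 * max 1 (db_size (db_of sigma R) * rpq_length q)"
      using enumeration[OF refl] by simp
  next
    fix w q R inp s up R' inp'
    show "\<exists>tr s'. exec ((sigma + 9) * w) inp' (update_routine ?A)
      (pass_update ((sigma + 9) * w) up s) tr s' \<and> outputs tr = [] \<and> length tr \<le> 1000"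
      by (intro exI[of _ "[Tick]"] exI conjI) (simp, rule exec_Skip, auto)
  qed
qed

end
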